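(* Let $(\mathbf{T}(t))_{t\ge0}$ be a Markov semigroup on $\mathcal{C}(\mathcal{Z})$ with stationary probability measure $\mu$, and let $(\mathbf{A},\mathcal{D}(\mathbf{A}))$ denote the generator of its extension to $L^2(\mu)$. Assume that $\mathbf{A}$ is normal on $L^2(\mu)$. Let $g_0\in\mathcal{D}(\mathbf{A}^\infty)$, let $g$ be the solution of $\dot g=\mathbf{A}g$ with $g(0)=g_0$, and set $\mathfrak{e}_m(t)=\mathrm{E}_m(g(t),g(t))$. Let $n\in\mathbb{N}$ be fixed such that $\mathfrak{e}_n(t)>0$ for all $t>0$. Then: 1. The trajectory $t\mapsto\mathfrak{e}_n(t)$ is log-convex in time, i.e. $\frac{\mathrm{d}^2}{\mathrm{d}t^2}\log\mathfrak{e}_n(t)\ge0$. 2. The function $t\mapsto\left(\frac{\mathfrak{e}_n(t)}{\mathfrak{e}_n(0)}\right)^{1/t}$ is increasing in time ($t>0$), and, moreover, it converges as $t\to\infty$.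
   Context: $\mathbb{N}=\{0,1,2,\dots\}$. $\mathcal{Z}$ is a compact metrizable topological space; $\mathcal{C}(\mathcal{Z})$ is the space of real-valued continuous functions on $\mathcal{Z}$ with the supremum norm and pointwise order; $\mathbf{1}$ is the constant function one. A Markov operator is a bounded linear operator $\mathbf{M}$ on $\mathcal{C}(\mathcal{Z})$ with $\mathbf{M}\mathbf{1}=\mathbf{1}$ and $\mathbf{M}g\ge0$ whenever $g\ge0$. A Markov semigroup $(\mathbf{T}(t))_{t\ge0}$ is a strongly continuous semigroup of Markov operators on $\mathcal{C}(\mathcal{Z})$. A stationary probability measure is a Borel probability measure $\mu$ on $\mathcal{Z}$ with $\int\mathbf{T}(t)g\,\mathrm{d}\mu=\int g\,\mathrm{d}\mu$ for all $g\in\mathcal{C}(\mathcal{Z})$ and $t\ge0$. $L^2(\mu)$ is the real Hilbert space with scalar product $(f,g)_\mu=\int_{\mathcal{Z}}f g\,\mathrm{d}\mu$ and norm $\|\cdot\|_\mu$. The semigroup $\mathbf{T}(t)$ extends to a strongly continuous contraction semigroup on $L^2(\mu)$, also denoted $\mathbf{T}(t)$; its generator on $L^2(\mu)$ is denoted $(\mathbf{A},\mathcal{D}(\mathbf{A}))$ with $\mathcal{D}(\mathbf{A})\subset L^2(\mu)$, and $\mathcal{D}(\mathbf{A}^\infty)=\bigcap_n\mathcal{D}(\mathbf{A}^n)$. The solution of $\dot g=\mathbf{A}g$, $g(0)=g_0$ is $g(t)=\mathbf{T}(t)g_0$. Let $\mathbf{A}^\star$ be the $L^2(\mu)$-adjoint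 of $\mathbf{A}$. $\mathbf{A}$ is normal if $\mathcal{D}(\mathbf{A})=\mathcal{D}(\mathbf{A}^\star)$ and $\|\mathbf{A}g\|_\mu=\|\mathbf{A}^\star g\|_\mu$ for all $g\in\mathcal{D}(\mathbf{A})$. Energies: $\mathrm{E}_0(f,g)=(f,g)_\mu-(f,\mathbf{1})_\mu(g,\mathbf{1})_\mu$ and $\mathrm{E}_{n+1}(f,g)=-\mathrm{E}_n(\mathbf{A}f,g)-\mathrm{E}_n(f,\mathbf{A}g)$. *)

theory Defs
  imports "HOL-Probability.Probability"
begin

text \<open>
  On a compact space every continuous function is bounded, so the type \<open>'a \<Rightarrow>\<^sub>C real\<close> of bounded
  continuous functions with the supremum norm is the space of all continuous functions.
\<close>

definition markov_operator ::
    "(('a::topological_space \<Rightarrow>\<^sub>C real) \<Rightarrow> ('a \<Rightarrow>\<^sub>C real)) \<Rightarrow> bool" where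
  "markov_operator P \<longleftrightarrow>
     bounded_linear P \<and>
     P (const_bcontfun 1) = const_bcontfun 1 \<and>
     (\<forall>g. (\<forall>x. 0 \<le> apply_bcontfun g x) \<longrightarrow> (\<forall>x. 0 \<le> apply_bcontfun (P g) x))"

definition markov_semigroup ::
    "(real \<Rightarrow> ('a::topological_space \<Rightarrow>\<^sub>C real) \<Rightarrow> ('a \<Rightarrow>\<^sub>C real)) \<Rightarrow> bool" where
  "markov_semigroup T \<longleftrightarrow>
     (\<forall>t\<ge>0. markov_operator (T t)) \<and>
     (\<forall>g. T 0 g = g) \<and>
     (\<forall>s\<ge>0. \<forall>t\<ge>0. \<forall>g. T (s + t) g = T s (T t g)) \<and>
     (\<forall>g. continuous_on {0..} (\<lambda>t. T t g))"

definition stationary_prob ::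
    "(real \<Rightarrow> ('a::topological_space \<Rightarrow>\<^sub>C real) \<Rightarrow> ('a \<Rightarrow>\<^sub>C real)) \<Rightarrow> 'a measure \<Rightarrow> bool" where
  "stationary_prob T M \<longleftrightarrow>
     prob_space M \<and> sets M = sets borel \<and>
     (\<forall>g. \<forall>t\<ge>0. (\<integral>x. apply_bcontfun (T t g) x \<partial>M) = (\<integral>x. apply_bcontfun g x \<partial>M))"

text \<open>
  Elements of \<open>L\<^sup>2(M)\<close> are handled through representatives: square-integrable measurable functions,
  two of which denote the same element iff they agree almost everywhere.  Operators on \<open>L\<^sup>2(M)\<close>
  are given by a function on representatives and, if unbounded, a domain.  The
  definitions below characterise their values only through inner products and \<open>L\<^sup>2\<close> norms, hence up
  to null sets, and pick one representative by Hilbert choice.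
\<close>

definition L2 :: "'a measure \<Rightarrow> ('a \<Rightarrow> real) set" where
  "L2 M = {f \<in> borel_measurable M. integrable M (\<lambda>x. (f x)\<^sup>2)}"

definition L2_inner :: "'a measure \<Rightarrow> ('a \<Rightarrow> real) \<Rightarrow> ('a \<Rightarrow> real) \<Rightarrow> real" where
  "L2_inner M f g = (\<integral>x. f x * g x \<partial>M)"

definition L2_norm :: "'a measure \<Rightarrow> ('a \<Rightarrow> real) \<Rightarrow> real" where
  "L2_norm M f = sqrt (L2_inner M f f)"

definition L2_tendsto ::
    "'a measure \<Rightarrow> ('b \<Rightarrow> 'a \<Rightarrow> real) \<Rightarrow> ('a \<Rightarrow> real) \<Rightarrow> 'b filter \<Rightarrow> bool" where
  "L2_tendsto M f l F \<longleftrightarrow> ((\<lambda>i. L2_norm M (\<lambda>x. f i x - l x)) \<longlongrightarrow> 0) F"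

text \<open>
  The continuous extension to \<open>L\<^sup>2(M)\<close> of an operator given on the dense subspace of continuous
  functions: \<open>h\<close> is the value at \<open>f\<close> iff \<open>\<phi>\<^sub>k \<rightarrow> f\<close> and \<open>P \<phi>\<^sub>k \<rightarrow> h\<close> in \<open>L\<^sup>2(M)\<close> for some sequence of
  continuous functions \<open>\<phi>\<^sub>k\<close>.
\<close>

definition L2_ext ::
    "'a measure \<Rightarrow> (('a::topological_space \<Rightarrow>\<^sub>C real) \<Rightarrow> ('a \<Rightarrow>\<^sub>C real)) \<Rightarrow> ('a \<Rightarrow> real) \<Rightarrow> ('a \<Rightarrow> real)" where
  "L2_ext M P f = (SOME h. h \<in> L2 M \<and>
     (\<exists>\<phi> :: nat \<Rightarrow> ('a \<Rightarrow>\<^sub>C real).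
        L2_tendsto M (\<lambda>k. apply_bcontfun (\<phi> k)) f sequentially \<and>
        L2_tendsto M (\<lambda>k. apply_bcontfun (P (\<phi> k))) h sequentially))"

definition L2_semigroup ::
    "'a measure \<Rightarrow> (real \<Rightarrow> ('a::topological_space \<Rightarrow>\<^sub>C real) \<Rightarrow> ('a \<Rightarrow>\<^sub>C real)) \<Rightarrow>
       real \<Rightarrow> ('a \<Rightarrow> real) \<Rightarrow> ('a \<Rightarrow> real)" where
  "L2_semigroup M T t = L2_ext M (T t)"

definition generates ::
    "'a measure \<Rightarrow> (real \<Rightarrow> ('a \<Rightarrow> real) \<Rightarrow> ('a \<Rightarrow> real)) \<Rightarrow> ('a \<Rightarrow> real) \<Rightarrow> ('a \<Rightarrow> real) \<Rightarrow> bool" where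
  "generates M S f h \<longleftrightarrow> h \<in> L2 M \<and> L2_tendsto M (\<lambda>t x. (S t f x - f x) / t) h (at_right 0)"

definition gen_dom ::
    "'a measure \<Rightarrow> (real \<Rightarrow> ('a \<Rightarrow> real) \<Rightarrow> ('a \<Rightarrow> real)) \<Rightarrow> ('a \<Rightarrow> real) set" where
  "gen_dom M S = {f \<in> L2 M. \<exists>h. generates M S f h}"

definition gen ::
    "'a measure \<Rightarrow> (real \<Rightarrow> ('a \<Rightarrow> real) \<Rightarrow> ('a \<Rightarrow> real)) \<Rightarrow> ('a \<Rightarrow> real) \<Rightarrow> ('a \<Rightarrow> real)" where
  "gen M S f = (SOME h. generates M S f h)"

primrec pow_dom ::
    "'a measure \<Rightarrow> ('a \<Rightarrow> real) set \<Rightarrow> (('a \<Rightarrow> real) \<Rightarrow> ('a \<Rightarrow> real)) \<Rightarrow> nat \<Rightarrow> ('a \<Rightarrow> real) set" where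
  "pow_dom M D A 0 = L2 M"
| "pow_dom M D A (Suc k) = {f \<in> D. A f \<in> pow_dom M D A k}"

definition inf_dom ::
    "'a measure \<Rightarrow> ('a \<Rightarrow> real) set \<Rightarrow> (('a \<Rightarrow> real) \<Rightarrow> ('a \<Rightarrow> real)) \<Rightarrow> ('a \<Rightarrow> real) set" where
  "inf_dom M D A = (\<Inter>k. pow_dom M D A k)"

definition is_adj ::
    "'a measure \<Rightarrow> ('a \<Rightarrow> real) set \<Rightarrow> (('a \<Rightarrow> real) \<Rightarrow> ('a \<Rightarrow> real)) \<Rightarrow>
       ('a \<Rightarrow> real) \<Rightarrow> ('a \<Rightarrow> real) \<Rightarrow> bool" where
  "is_adj M D A g h \<longleftrightarrow> h \<in> L2 M \<and> (\<forall>f\<in>D. L2_inner M (A f) g = L2_inner M f h)"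

definition adj_dom ::
    "'a measure \<Rightarrow> ('a \<Rightarrow> real) set \<Rightarrow> (('a \<Rightarrow> real) \<Rightarrow> ('a \<Rightarrow> real)) \<Rightarrow> ('a \<Rightarrow> real) set" where
  "adj_dom M D A = {g \<in> L2 M. \<exists>h. is_adj M D A g h}"

definition adj ::
    "'a measure \<Rightarrow> ('a \<Rightarrow> real) set \<Rightarrow> (('a \<Rightarrow> real) \<Rightarrow> ('a \<Rightarrow> real)) \<Rightarrow> ('a \<Rightarrow> real) \<Rightarrow> ('a \<Rightarrow> real)" where
  "adj M D A g = (SOME h. is_adj M D A g h)"

definition normal_operator ::
    "'a measure \<Rightarrow> ('a \<Rightarrow> real) set \<Rightarrow> (('a \<Rightarrow> real) \<Rightarrow> ('a \<Rightarrow> real)) \<Rightarrow> bool" where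
  "normal_operator M D A \<longleftrightarrow>
     D = adj_dom M D A \<and> (\<forall>g\<in>D. L2_norm M (A g) = L2_norm M (adj M D A g))"

primrec energy ::
    "'a measure \<Rightarrow> (('a \<Rightarrow> real) \<Rightarrow> ('a \<Rightarrow> real)) \<Rightarrow> nat \<Rightarrow> ('a \<Rightarrow> real) \<Rightarrow> ('a \<Rightarrow> real) \<Rightarrow> real" where
  "energy M A 0 = (\<lambda>f g. L2_inner M f g - L2_inner M f (\<lambda>_. 1) * L2_inner M g (\<lambda>_. 1))"
| "energy M A (Suc k) = (\<lambda>f g. - energy M A k (A f) g - energy M A k f (A g))"

end

theory Submission
  imports Defs
begin

text \<open>
  Let \<open>B\<close> be the adjoint of the generator \<open>A\<close> and put \<open>R = - (A + B)\<close> (\<open>dissip\<close>).  Since \<open>A\<close> is normal, \<open>A\<close> and \<open>B\<close>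
  commute, so \<open>E\<^bsub>n+1\<^esub>(f, g) = E\<^sub>n(R f, g)\<close> and \<open>E\<^bsub>n+2\<^esub>(f, f) = E\<^sub>n(R f, R f)\<close>.  With \<open>E\<^sub>0 \<ge> 0\<close> (variance)
  and \<open>E\<^sub>1 \<ge> 0\<close> (dissipativity) every \<open>E\<^sub>n\<close> is a positive semidefinite symmetric form, and its
  Cauchy-Schwarz inequality for \<open>f\<close> and \<open>R f\<close> reads \<open>e\<^bsub>n+1\<^esub>\<^sup>2 \<le> e\<^sub>n e\<^bsub>n+2\<^esub>\<close>.  As \<open>e\<^sub>n' = - e\<^bsub>n+1\<^esub>\<close>, this
  is log-convexity, and the roots of the second claim are exponentials of slopes of \<open>ln e\<^sub>n\<close> at \<open>0\<close>.
  Commutation needs that the adjoint of \<open>B\<close> is \<open>A\<close>, which follows by projecting onto the graph of \<open>A\<close>.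
\<close>

text \<open>The values of the operators are Hilbert choices of representatives, so \<open>A\<close>,
  its adjoint and the semigroup are linear, and commute, only up to null sets. Operator identities
  are therefore stated with \<open>L2_eq\<close>, and domains, powers and energies get congruence
  rules before they are manipulated. Normality supplies two facts of different use. Equality of
  domains means that a weak image under the adjoint already proves membership in the domain.
  Equality of norms, polarised, relates \<open>(A f, A g)\<close> to \<open>(B f, B g)\<close>; this
  says something about pairings with \<open>B h\<close>, and only the second adjoint leads from
  there back to the domain of \<open>A\<close>. The spectral theorem is avoided: completeness and
  one projection suffice. Positivity of \<open>e n\<close> is given for positive times only. It
  extends to time 0 because the next energy is nonnegative, so that \<open>e n\<close> decreases;
  the same monotonicity bounds the roots by 1, and increasing bounded functions converge.\<close>

lemma quadratic_nonneg_imp: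
  fixes a b c :: real
  assumes "\<And>s. 0 \<le> a + 2 * s * b + s\<^sup>2 * c"
  shows "b\<^sup>2 \<le> a * c"
proof -
  have a0: "0 \<le> a" using assms[of 0] by simp
  have c0: "0 \<le> c"
  proof (rule ccontr)
    assume "\<not> 0 \<le> c"
    then have c: "c < 0" by simp
    \<comment> \<open>Large enough that \<open>s \<ge> 1\<close> and
      \<open>s * c < - (a + 2 * \<bar>b\<bar>)\<close>: after division by \<open>s\<close> the
      quadratic term outweighs the other two.\<close>
    define s where "s = (a + 2 * \<bar>b\<bar> + 1) / (- c) + 1"
    have s1: "1 \<le> s" unfolding s_def using a0 c by (simp add: divide_nonneg_pos divide_nonneg_neg)
    have "s * (- c) = a + 2 * \<bar>b\<bar> + 1 - c" unfolding s_def using c by (simp add: field_simps)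
    then have sc: "s * c < - (a + 2 * \<bar>b\<bar>)" using c by linarith
    have "a + 2 * s * b + s\<^sup>2 * c \<le> a * s + s * (2 * \<bar>b\<bar>) + s * (s * c)"
    proof -
      have "a \<le> a * s" using a0 s1 by (simp add: mult_le_cancel_left1)
      moreover have "2 * s * b \<le> s * (2 * \<bar>b\<bar>)" using s1 by (simp add: mult_left_mono)
      ultimately show ?thesis by (simp add: power2_eq_square)
    qed
    also have "\<dots> = s * (a + 2 * \<bar>b\<bar> + s * c)" by (simp add: algebra_simps)
    also have "\<dots> < 0" using s1 sc by (simp add: mult_less_0_iff)
    finally show False using assms[of s] by simp
  qed
  show ?thesis
  proof (cases "c = 0")
    case True
    have "b = 0"
    proof (rule ccontr)
      assume "b \<noteq> 0"
      \<comment> \<open>With \<open>c = 0\<close> this point makes the expression equal to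
        \<open>-1\<close>.\<close>
      with assms[of "- (a + 1) / (2 * b)"] True show False by (simp add: field_simps)
    qed
    with True show ?thesis by simp
  next
    case False
    with c0 have c: "0 < c" by simp
    \<comment> \<open>The minimiser of the quadratic; multiplying by \<open>c\<close> clears the
      denominators.\<close>
    from assms[of "- b / c"] have "0 \<le> c * (a + 2 * (- b / c) * b + (- b / c)\<^sup>2 * c)" using c0 by simp
    also have "\<dots> = a * c - b\<^sup>2" using c by (simp add: field_simps power2_eq_square)
    finally show ?thesis by simp
  qed
qed

section \<open>The space of square-integrable functions\<close>

lemma L2_measurable[measurable_dest]: "f \<in> L2 M \<Longrightarrow> f \<in> borel_measurable M"
  by (simp add: L2_def)

lemma L2_square_integrable: "f \<in> L2 M \<Longrightarrow> integrable M (\<lambda>x. f x * f x)"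
  by (simp add: L2_def power2_eq_square)

lemma L2_mult_integrable:
  assumes [measurable]: "f \<in> L2 M" "g \<in> L2 M"
  shows "integrable M (\<lambda>x. f x * g x)"
proof (rule Bochner_Integration.integrable_bound)
  show "integrable M (\<lambda>x. f x * f x + g x * g x)"
    using assms by (intro Bochner_Integration.integrable_add L2_square_integrable)
  show "AE x in M. norm (f x * g x) \<le> norm (f x * f x + g x * g x)"
  proof (intro AE_I2)
    fix x
    have "0 \<le> (\<bar>f x\<bar> - \<bar>g x\<bar>)\<^sup>2" by simp
    then have "2 * (\<bar>f x\<bar> * \<bar>g x\<bar>) \<le> f x * f x + g x * g x"
      by (simp add: power2_diff) (simp add: power2_eq_square)
    moreover have "0 \<le> \<bar>f x\<bar> * \<bar>g x\<bar>" by simp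
    ultimately have "\<bar>f x\<bar> * \<bar>g x\<bar> \<le> f x * f x + g x * g x" by linarith
    then show "norm (f x * g x) \<le> norm (f x * f x + g x * g x)"
      by (simp add: abs_mult)
  qed
qed measurable

lemma L2_scale[intro, simp]: "f \<in> L2 M \<Longrightarrow> (\<lambda>x. c * f x) \<in> L2 M"
  by (auto simp: L2_def power_mult_distrib)

lemma L2_add[intro, simp]:
  assumes "f \<in> L2 M" "g \<in> L2 M"
  shows "(\<lambda>x. f x + g x) \<in> L2 M"
proof -
  have "integrable M (\<lambda>x. f x * f x + g x * g x + 2 * (f x * g x))"
    using assms by (intro Bochner_Integration.integrable_add integrable_mult_right L2_mult_integrable)
  then show ?thesis using assms
    by (auto simp: L2_def power2_eq_square algebra_simps)
qed

lemma L2_uminus[intro, simp]: "f \<in> L2 M \<Longrightarrow> (\<lambda>x. - f x) \<in> L2 M"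
  using L2_scale[of f M "-1"] by simp

lemma L2_diff[intro, simp]: "f \<in> L2 M \<Longrightarrow> g \<in> L2 M \<Longrightarrow> (\<lambda>x. f x - g x) \<in> L2 M"
  using L2_add[of f M "\<lambda>x. - g x"] by simp

lemma L2_divide[intro, simp]: "f \<in> L2 M \<Longrightarrow> (\<lambda>x. f x / c) \<in> L2 M"
  using L2_scale[of f M "1 / c"] by simp

lemma L2_zero[simp]: "(\<lambda>x. 0) \<in> L2 M"
  by (simp add: L2_def)

lemma (in prob_space) L2_const[simp]: "(\<lambda>x. c) \<in> L2 M"
  by (simp add: L2_def)

lemma L2_inner_commute: "L2_inner M f g = L2_inner M g f"
  by (simp add: L2_inner_def mult.commute)

lemma L2_inner_add_left:
  "f \<in> L2 M \<Longrightarrow> g \<in> L2 M \<Longrightarrow> h \<in> L2 M \<Longrightarrow>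
    L2_inner M (\<lambda>x. f x + g x) h = L2_inner M f h + L2_inner M g h"
  by (simp add: L2_inner_def distrib_right L2_mult_integrable)

lemma L2_inner_diff_left:
  "f \<in> L2 M \<Longrightarrow> g \<in> L2 M \<Longrightarrow> h \<in> L2 M \<Longrightarrow>
    L2_inner M (\<lambda>x. f x - g x) h = L2_inner M f h - L2_inner M g h"
  by (simp add: L2_inner_def left_diff_distrib L2_mult_integrable)

lemma L2_inner_scale_left: "L2_inner M (\<lambda>x. c * f x) h = c * L2_inner M f h"
  by (simp add: L2_inner_def mult.assoc)

lemma L2_inner_uminus_left: "L2_inner M (\<lambda>x. - f x) h = - L2_inner M f h"
  by (simp add: L2_inner_def)

lemma L2_inner_divide_left: "L2_inner M (\<lambda>x. f x / c) h = L2_inner M f h / c"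
  using L2_inner_scale_left[of M "1 / c" f h] by simp

lemma L2_inner_add_right:
  "f \<in> L2 M \<Longrightarrow> g \<in> L2 M \<Longrightarrow> h \<in> L2 M \<Longrightarrow>
    L2_inner M h (\<lambda>x. f x + g x) = L2_inner M h f + L2_inner M h g"
  by (simp add: L2_inner_def distrib_left L2_mult_integrable)

lemma L2_inner_diff_right:
  "f \<in> L2 M \<Longrightarrow> g \<in> L2 M \<Longrightarrow> h \<in> L2 M \<Longrightarrow>
    L2_inner M h (\<lambda>x. f x - g x) = L2_inner M h f - L2_inner M h g"
  by (simp add: L2_inner_def right_diff_distrib L2_mult_integrable)

lemma L2_inner_scale_right: "L2_inner M h (\<lambda>x. c * f x) = c * L2_inner M h f"
  unfolding L2_inner_commute[of M h] by (rule L2_inner_scale_left)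

lemma L2_inner_uminus_right: "L2_inner M h (\<lambda>x. - f x) = - L2_inner M h f"
  unfolding L2_inner_commute[of M h] by (rule L2_inner_uminus_left)

lemma L2_inner_divide_right: "L2_inner M h (\<lambda>x. f x / c) = L2_inner M h f / c"
  unfolding L2_inner_commute[of M h] by (rule L2_inner_divide_left)

lemmas L2_inner_simps = L2_inner_add_left L2_inner_add_right L2_inner_diff_left L2_inner_diff_right
  L2_inner_scale_left L2_inner_scale_right L2_inner_uminus_left L2_inner_uminus_right
  L2_inner_divide_left L2_inner_divide_right

lemma L2_inner_self_nonneg[simp]: "0 \<le> L2_inner M f f"
  by (simp add: L2_inner_def)

lemma L2_norm_nonneg[simp]: "0 \<le> L2_norm M f"
  by (simp add: L2_norm_def)

lemma L2_norm_zero[simp]: "L2_norm M (\<lambda>x. 0) = 0"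
  by (simp add: L2_norm_def L2_inner_def)

lemma L2_norm_square: "(L2_norm M f)\<^sup>2 = L2_inner M f f"
  by (simp add: L2_norm_def)

lemma L2_norm_minus_commute: "L2_norm M (\<lambda>x. f x - g x) = L2_norm M (\<lambda>x. g x - f x)"
proof -
  have "(f x - g x) * (f x - g x) = (g x - f x) * (g x - f x)" for x by algebra
  then show ?thesis by (simp add: L2_norm_def L2_inner_def)
qed

lemma L2_norm_scale: "L2_norm M (\<lambda>x. c * f x) = \<bar>c\<bar> * L2_norm M f"
  by (simp add: L2_norm_def L2_inner_simps mult.assoc[symmetric] real_sqrt_mult del: mult.assoc)

text \<open>On representatives \<open>L2_inner\<close> is only semidefinite, so a nonzero function
  \<open>g\<close> may have norm zero. The discriminant of the square of \<open>f + s * g\<close>,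
  as a polynomial in \<open>s\<close>, covers that case too.\<close>

lemma L2_Cauchy_Schwarz:
  assumes "f \<in> L2 M" "g \<in> L2 M"
  shows "\<bar>L2_inner M f g\<bar> \<le> L2_norm M f * L2_norm M g"
proof -
  have "(L2_inner M f g)\<^sup>2 \<le> L2_inner M f f * L2_inner M g g"
  proof (rule quadratic_nonneg_imp)
    fix s
    have "0 \<le> L2_inner M (\<lambda>x. f x + s * g x) (\<lambda>x. f x + s * g x)" by simp
    then show "0 \<le> L2_inner M f f + 2 * s * L2_inner M f g + s\<^sup>2 * L2_inner M g g"
      using assms by (simp add: L2_inner_simps L2_inner_commute[of M g f] algebra_simps power2_eq_square)
  qed
  then have "sqrt ((L2_inner M f g)\<^sup>2) \<le> sqrt (L2_inner M f f * L2_inner M g g)"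
    by (rule real_sqrt_le_mono)
  then show ?thesis by (simp add: L2_norm_def real_sqrt_mult)
qed

lemma L2_norm_triangle:
  assumes "f \<in> L2 M" "g \<in> L2 M"
  shows "L2_norm M (\<lambda>x. f x + g x) \<le> L2_norm M f + L2_norm M g"
proof (rule power2_le_imp_le)
  show "(L2_norm M (\<lambda>x. f x + g x))\<^sup>2 \<le> (L2_norm M f + L2_norm M g)\<^sup>2"
    using L2_Cauchy_Schwarz[OF assms] assms
    by (simp add: L2_norm_square power2_sum L2_inner_simps L2_inner_commute[of M g f])
qed simp

lemma L2_norm_diff_triangle:
  assumes "f \<in> L2 M" "g \<in> L2 M" "h \<in> L2 M"
  shows "L2_norm M (\<lambda>x. f x - h x) \<le> L2_norm M (\<lambda>x. f x - g x) + L2_norm M (\<lambda>x. g x - h x)"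
  using L2_norm_triangle[of "\<lambda>x. f x - g x" M "\<lambda>x. g x - h x"] assms by simp

text \<open>Equality as elements of the Hilbert space, phrased by distance so that its congruence
  rules come from the triangle inequality and Cauchy-Schwarz without mention of null sets.
  Membership is built in, so the rules carry it along.\<close>

definition L2_eq :: "'a measure \<Rightarrow> ('a \<Rightarrow> real) \<Rightarrow> ('a \<Rightarrow> real) \<Rightarrow> bool" where
  "L2_eq M f g \<longleftrightarrow> f \<in> L2 M \<and> g \<in> L2 M \<and> L2_norm M (\<lambda>x. f x - g x) = 0"

lemma L2_eq_memD: "L2_eq M f g \<Longrightarrow> f \<in> L2 M" "L2_eq M f g \<Longrightarrow> g \<in> L2 M"
  by (auto simp: L2_eq_def)

lemma L2_eq_refl[simp]: "f \<in> L2 M \<Longrightarrow> L2_eq M f f"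
  by (simp add: L2_eq_def)

lemma L2_eq_sym: "L2_eq M f g \<Longrightarrow> L2_eq M g f"
  by (simp add: L2_eq_def L2_norm_minus_commute[of M f g])

lemma L2_eq_trans[trans]: "L2_eq M f g \<Longrightarrow> L2_eq M g h \<Longrightarrow> L2_eq M f h"
  using L2_norm_diff_triangle[of f M g h]
  by (auto simp: L2_eq_def intro: antisym)

lemma L2_inner_cong_left:
  assumes "L2_eq M f g" "h \<in> L2 M"
  shows "L2_inner M f h = L2_inner M g h"
  using L2_Cauchy_Schwarz[of "\<lambda>x. f x - g x" M h] assms by (auto simp: L2_eq_def L2_inner_simps)

lemma L2_inner_cong:
  assumes "L2_eq M f f'" "L2_eq M g g'"
  shows "L2_inner M f g = L2_inner M f' g'"
  using assms L2_inner_cong_left L2_inner_commute L2_eq_memD by metis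

lemma L2_norm_cong: "L2_eq M f g \<Longrightarrow> L2_norm M f = L2_norm M g"
  unfolding L2_norm_def using L2_inner_cong by metis

lemma L2_eq_scale: "L2_eq M f g \<Longrightarrow> L2_eq M (\<lambda>x. c * f x) (\<lambda>x. c * g x)"
  using L2_norm_scale[of M c "\<lambda>x. f x - g x"] by (simp add: L2_eq_def right_diff_distrib)

lemma L2_eq_add:
  assumes "L2_eq M f f'" "L2_eq M g g'"
  shows "L2_eq M (\<lambda>x. f x + g x) (\<lambda>x. f' x + g' x)"
  using assms L2_norm_triangle[of "\<lambda>x. f x - f' x" M "\<lambda>x. g x - g' x"]
  by (auto simp: L2_eq_def algebra_simps intro: antisym)

lemma L2_eq_uminus: "L2_eq M f g \<Longrightarrow> L2_eq M (\<lambda>x. - f x) (\<lambda>x. - g x)"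
  using L2_eq_scale[of M f g "-1"] by simp

lemma L2_eq_diff:
  assumes "L2_eq M f f'" "L2_eq M g g'"
  shows "L2_eq M (\<lambda>x. f x - g x) (\<lambda>x. f' x - g' x)"
  using L2_eq_add[OF assms(1) L2_eq_uminus[OF assms(2)]] by simp

lemma L2_eq_divide: "L2_eq M f g \<Longrightarrow> L2_eq M (\<lambda>x. f x / c) (\<lambda>x. g x / c)"
  using L2_eq_scale[of M f g "1/c"] by simp

section \<open>Convergence in the norm of \<open>L2 M\<close>\<close>

lemma L2_tendsto_norm_le:
  assumes "f' \<in> L2 M" "\<forall>\<^sub>F i in F. f i \<in> L2 M" "L2_tendsto M f f' F" "F \<noteq> bot"
    "\<forall>\<^sub>F i in F. L2_norm M (f i) \<le> c i" "(c \<longlongrightarrow> C) F"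
  shows "L2_norm M f' \<le> C"
proof -
  have "((\<lambda>i. L2_norm M (\<lambda>x. f i x - f' x) + c i) \<longlongrightarrow> 0 + C) F"
    using assms(3) assms(6) unfolding L2_tendsto_def by (intro tendsto_add)
  moreover have "\<forall>\<^sub>F i in F. L2_norm M f' \<le> L2_norm M (\<lambda>x. f i x - f' x) + c i"
    using assms(2,5)
  proof eventually_elim
    case (elim i)
    have "L2_norm M f' \<le> L2_norm M (\<lambda>x. f' x - f i x) + L2_norm M (f i)"
      using L2_norm_triangle[of "\<lambda>x. f' x - f i x" M "f i"] assms elim by simp
    with elim show ?case by (simp add: L2_norm_minus_commute[of M f'])
  qed
  ultimately show ?thesis using assms(4) tendsto_lowerbound by fastforce
qed

lemma L2_tendsto_norm:
  assumes "f' \<in> L2 M" "\<forall>\<^sub>F i in F. f i \<in> L2 M" "L2_tendsto M f f' F"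
  shows "((\<lambda>i. L2_norm M (f i)) \<longlongrightarrow> L2_norm M f') F"
proof (rule LIM_zero_cancel, rule Lim_null_comparison)
  show "\<forall>\<^sub>F i in F. norm (L2_norm M (f i) - L2_norm M f') \<le> L2_norm M (\<lambda>x. f i x - f' x)"
    using assms(2)
  proof eventually_elim
    case (elim i)
    then show ?case
      using L2_norm_triangle[of "\<lambda>x. f i x - f' x" M f'] L2_norm_triangle[of "\<lambda>x. f' x - f i x" M "f i"]
        assms(1) L2_norm_minus_commute[of M "f i" f'] by auto
  qed
qed (use assms(3) in \<open>simp add: L2_tendsto_def\<close>)

text \<open>Both arguments move because this has to yield the product rule for
  \<open>(S s f, S s g)\<close>. The moving factor \<open>g i\<close> multiplies the first error, so
  its norm must stay bounded, which \<open>L2_tendsto_norm\<close> provides.\<close>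

lemma L2_tendsto_inner_both:
  assumes f: "f' \<in> L2 M" "\<forall>\<^sub>F i in F. f i \<in> L2 M" "L2_tendsto M f f' F"
    and g: "g' \<in> L2 M" "\<forall>\<^sub>F i in F. g i \<in> L2 M" "L2_tendsto M g g' F"
  shows "((\<lambda>i. L2_inner M (f i) (g i)) \<longlongrightarrow> L2_inner M f' g') F"
proof (rule LIM_zero_cancel, rule Lim_null_comparison)
  have "((\<lambda>i. L2_norm M (\<lambda>x. f i x - f' x) * L2_norm M (g i)
      + L2_norm M f' * L2_norm M (\<lambda>x. g i x - g' x)) \<longlongrightarrow> 0 * L2_norm M g' + L2_norm M f' * 0) F"
    using f(3) g(3) L2_tendsto_norm[OF g] unfolding L2_tendsto_def by (intro tendsto_intros)
  then show "((\<lambda>i. L2_norm M (\<lambda>x. f i x - f' x) * L2_norm M (g i)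
      + L2_norm M f' * L2_norm M (\<lambda>x. g i x - g' x)) \<longlongrightarrow> 0) F" by simp
  show "\<forall>\<^sub>F i in F. norm (L2_inner M (f i) (g i) - L2_inner M f' g')
    \<le> L2_norm M (\<lambda>x. f i x - f' x) * L2_norm M (g i) + L2_norm M f' * L2_norm M (\<lambda>x. g i x - g' x)"
    using f(2) g(2)
  proof eventually_elim
    case (elim i)
    have "L2_inner M (f i) (g i) - L2_inner M f' g'
        = L2_inner M (\<lambda>x. f i x - f' x) (g i) + L2_inner M f' (\<lambda>x. g i x - g' x)"
      using elim f(1) g(1) by (simp add: L2_inner_simps)
    then show ?case
      using L2_Cauchy_Schwarz[of "\<lambda>x. f i x - f' x" M "g i"]
        L2_Cauchy_Schwarz[of f' M "\<lambda>x. g i x - g' x"] elim f(1) g(1) by simp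
  qed
qed

lemma L2_tendsto_const: "L2_tendsto M (\<lambda>_. f) f F"
  by (simp add: L2_tendsto_def)

lemma L2_tendsto_inner:
  assumes "f' \<in> L2 M" "\<forall>\<^sub>F i in F. f i \<in> L2 M" "L2_tendsto M f f' F" "h \<in> L2 M"
  shows "((\<lambda>i. L2_inner M (f i) h) \<longlongrightarrow> L2_inner M f' h) F"
  using L2_tendsto_inner_both[OF assms(1-3) assms(4) _ L2_tendsto_const] assms(4) by simp

lemma L2_tendsto_add:
  assumes "f' \<in> L2 M" "\<forall>\<^sub>F i in F. f i \<in> L2 M" "L2_tendsto M f f' F"
    "g' \<in> L2 M" "\<forall>\<^sub>F i in F. g i \<in> L2 M" "L2_tendsto M g g' F"
  shows "L2_tendsto M (\<lambda>i x. f i x + g i x) (\<lambda>x. f' x + g' x) F"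
  unfolding L2_tendsto_def
proof (rule Lim_null_comparison)
  show "((\<lambda>i. L2_norm M (\<lambda>x. f i x - f' x) + L2_norm M (\<lambda>x. g i x - g' x)) \<longlongrightarrow> 0) F"
    using assms unfolding L2_tendsto_def by (intro tendsto_add_zero)
  show "\<forall>\<^sub>F i in F. norm (L2_norm M (\<lambda>x. f i x + g i x - (f' x + g' x)))
    \<le> L2_norm M (\<lambda>x. f i x - f' x) + L2_norm M (\<lambda>x. g i x - g' x)"
    using assms(2,5)
  proof eventually_elim
    case (elim i)
    then show ?case
      using L2_norm_triangle[of "\<lambda>x. f i x - f' x" M "\<lambda>x. g i x - g' x"] assms(1,4)
      by (simp add: algebra_simps)
  qed
qed

lemma L2_tendsto_scale:
  assumes "L2_tendsto M f f' F"
  shows "L2_tendsto M (\<lambda>i x. c * f i x) (\<lambda>x. c * f' x) F"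
proof -
  have "((\<lambda>i. \<bar>c\<bar> * L2_norm M (\<lambda>x. f i x - f' x)) \<longlongrightarrow> 0) F"
    using assms unfolding L2_tendsto_def by (rule tendsto_mult_right_zero)
  then show ?thesis
    unfolding L2_tendsto_def by (simp flip: L2_norm_scale right_diff_distrib)
qed

lemma L2_tendsto_cong:
  assumes "L2_eq M f' g'" "\<forall>\<^sub>F i in F. L2_eq M (f i) (g i)" "L2_tendsto M f f' F"
  shows "L2_tendsto M g g' F"
proof -
  have "\<forall>\<^sub>F i in F. L2_norm M (\<lambda>x. f i x - f' x) = L2_norm M (\<lambda>x. g i x - g' x)"
    using assms(2) by eventually_elim (intro L2_norm_cong L2_eq_diff assms(1))
  then show ?thesis using assms(3) unfolding L2_tendsto_def by (rule Lim_transform_eventually[rotated])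
qed

lemma L2_tendsto_unique:
  assumes "f' \<in> L2 M" "f'' \<in> L2 M" "\<forall>\<^sub>F i in F. f i \<in> L2 M"
    "L2_tendsto M f f' F" "L2_tendsto M f f'' F" "F \<noteq> bot"
  shows "L2_eq M f' f''"
proof -
  have scale: "\<forall>\<^sub>F i in F. (\<lambda>x. (-1) * f i x) \<in> L2 M"
    using assms(3) by eventually_elim (rule L2_scale)
  \<comment> \<open>The sequence minus itself is constantly zero and tends to
    \<open>f' - f''\<close>, so this difference has norm zero.\<close>
  have "L2_tendsto M (\<lambda>i x. f i x + (-1) * f i x) (\<lambda>x. f' x + (-1) * f'' x) F"
    using assms scale by (intro L2_tendsto_add L2_tendsto_scale L2_scale)
  then have "L2_norm M (\<lambda>x. f' x + (-1) * f'' x) \<le> 0"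
    using assms by (intro L2_tendsto_norm_le[where F = F and c = "\<lambda>_. 0"]) auto
  then show ?thesis using assms by (auto simp: L2_eq_def intro: antisym)
qed

section \<open>Completeness and dominated convergence in \<open>L2 M\<close>\<close>

context prob_space
begin

text \<open>Fatou's lemma for the squares. Besides the bound it shows that an almost-everywhere
  limit is square-integrable at all, which completeness needs.\<close>

lemma L2_Fatou:
  assumes h: "\<And>j. h j \<in> L2 M" and g[measurable]: "g \<in> borel_measurable M"
    and lim: "AE x in M. (\<lambda>j. h j x) \<longlonglongrightarrow> g x"
    and c: "\<forall>\<^sub>F j in sequentially. L2_norm M (h j) \<le> c"
  shows "g \<in> L2 M" "L2_norm M g \<le> c"
proof -
  have [measurable]: "h j \<in> borel_measurable M" for j using h by auto
  have c0: "0 \<le> c"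
    using c eventually_happens'[OF sequentially_bot] L2_norm_nonneg order_trans by blast
  have int: "(\<integral>\<^sup>+x. ennreal ((h j x)\<^sup>2) \<partial>M) = ennreal ((L2_norm M (h j))\<^sup>2)" for j
    using h[of j] by (subst nn_integral_eq_integral)
      (auto simp: L2_def L2_norm_square L2_inner_def simp flip: power2_eq_square)
  have "(\<integral>\<^sup>+x. ennreal ((g x)\<^sup>2) \<partial>M) = (\<integral>\<^sup>+x. liminf (\<lambda>j. ennreal ((h j x)\<^sup>2)) \<partial>M)"
    using lim
  proof (intro nn_integral_cong_AE, eventually_elim)
    case (elim x)
    then have "(\<lambda>j. ennreal ((h j x)\<^sup>2)) \<longlonglongrightarrow> ennreal ((g x)\<^sup>2)"
      by (intro tendsto_intros)
    then show ?case by (metis lim_imp_Liminf sequentially_bot)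
  qed
  also have "\<dots> \<le> liminf (\<lambda>j. \<integral>\<^sup>+x. ennreal ((h j x)\<^sup>2) \<partial>M)"
    by (rule nn_integral_liminf) measurable
  also have "\<dots> \<le> ennreal (c\<^sup>2)"
  proof -
    have "\<forall>\<^sub>F j in sequentially. (\<integral>\<^sup>+x. ennreal ((h j x)\<^sup>2) \<partial>M) \<le> ennreal (c\<^sup>2)"
      using c by eventually_elim (auto simp: int intro!: ennreal_leI power_mono)
    then have "liminf (\<lambda>j. \<integral>\<^sup>+x. ennreal ((h j x)\<^sup>2) \<partial>M) \<le> liminf (\<lambda>j::nat. ennreal (c\<^sup>2))"
      by (rule Liminf_mono)
    then show ?thesis by (simp add: Liminf_const)
  qed
  finally have le: "(\<integral>\<^sup>+x. ennreal ((g x)\<^sup>2) \<partial>M) \<le> ennreal (c\<^sup>2)" .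
  then have "integrable M (\<lambda>x. (g x)\<^sup>2)"
    by (intro integrableI_bounded) (auto intro: le_less_trans)
  then show mem: "g \<in> L2 M" by (simp add: L2_def)
  have "ennreal ((L2_norm M g)\<^sup>2) = (\<integral>\<^sup>+x. ennreal ((g x)\<^sup>2) \<partial>M)"
    using mem by (subst nn_integral_eq_integral)
      (auto simp: L2_def L2_norm_square L2_inner_def simp flip: power2_eq_square)
  with le have "(L2_norm M g)\<^sup>2 \<le> c\<^sup>2" by (metis ennreal_le_iff zero_le_power2)
  then show "L2_norm M g \<le> c" using c0 by (rule power2_le_imp_le)
qed

text \<open>Riesz-Fischer. On a probability space the L2 norm dominates the L1 norm, so some
  subsequence is Cauchy almost everywhere; Fatou turns its pointwise limit into a limit in norm of
  the whole sequence.\<close>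

lemma L2_complete:
  assumes f: "\<And>n. f n \<in> L2 M"
    and C: "\<And>e. 0 < e \<Longrightarrow> \<exists>N. \<forall>m\<ge>N. \<forall>n\<ge>N. L2_norm M (\<lambda>x. f m x - f n x) < e"
  shows "\<exists>l\<in>L2 M. L2_tendsto M f l sequentially"
proof -
  have [measurable]: "f n \<in> borel_measurable M" for n using f by auto
  have L1: "(LINT x|M. norm (f i x - f j x)) \<le> L2_norm M (\<lambda>x. f i x - f j x)" for i j
  proof -
    have abs: "(\<lambda>x. \<bar>f i x - f j x\<bar>) \<in> L2 M"
      using L2_diff[OF f f] by (simp add: L2_def)
    have "(LINT x|M. norm (f i x - f j x)) = L2_inner M (\<lambda>x. \<bar>f i x - f j x\<bar>) (\<lambda>x. 1)"
      by (simp add: L2_inner_def)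
    also have "\<dots> \<le> L2_norm M (\<lambda>x. \<bar>f i x - f j x\<bar>) * L2_norm M (\<lambda>x. 1)"
      using L2_Cauchy_Schwarz[OF abs L2_const[of 1]] by linarith
    also have "\<dots> = L2_norm M (\<lambda>x. f i x - f j x)"
      by (simp add: L2_norm_def L2_inner_def prob_space)
    finally show ?thesis .
  qed
  have "integrable M (f n)" for n
    using L2_mult_integrable[OF f L2_const[of 1]] by simp
  moreover have "\<exists>N. \<forall>i\<ge>N. \<forall>j\<ge>N. (LINT x|M. norm (f i x - f j x)) < e" if "0 < e" for e
    using C[OF that] L1 by (meson le_less_trans)
  ultimately obtain r where r: "strict_mono r" "AE x in M. Cauchy (\<lambda>i. f (r i) x)"
    by (rule cauchy_L1_AE_cauchy_subseq)
  \<comment> \<open>Where the subsequence diverges \<open>lim\<close> is unspecified; this happens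
    only on a null set.\<close>
  define l where "l x = lim (\<lambda>i. f (r i) x)" for x
  have [measurable]: "l \<in> borel_measurable M" unfolding l_def by measurable
  have lim: "AE x in M. (\<lambda>i. f (r i) x) \<longlonglongrightarrow> l x"
    using r(2) by eventually_elim (simp add: l_def Cauchy_convergent_iff convergent_LIMSEQ_iff)
  \<comment> \<open>\<open>n\<close> stays fixed while the second index runs along the subsequence,
    so the Cauchy bound passes to \<open>f n - l\<close>.\<close>
  have key: "(\<lambda>x. f n x - l x) \<in> L2 M \<and> L2_norm M (\<lambda>x. f n x - l x) \<le> e"
    if N: "\<forall>m\<ge>N. \<forall>n\<ge>N. L2_norm M (\<lambda>x. f m x - f n x) < e" and n: "n \<ge> N" for n N e
  proof -
    have mem: "(\<lambda>x. f n x - f (r j) x) \<in> L2 M" for j using f by simp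
    have meas: "(\<lambda>x. f n x - l x) \<in> borel_measurable M" by measurable
    have AE: "AE x in M. (\<lambda>j. f n x - f (r j) x) \<longlonglongrightarrow> f n x - l x"
      using lim by eventually_elim (intro tendsto_intros)
    have ev: "\<forall>\<^sub>F j in sequentially. L2_norm M (\<lambda>x. f n x - f (r j) x) \<le> e"
      unfolding eventually_sequentially using N n seq_suble[OF r(1)]
      by (meson le_trans less_imp_le)
    show ?thesis using L2_Fatou[OF mem meas AE ev] by blast
  qed
  obtain N where "(\<lambda>x. f N x - l x) \<in> L2 M"
    using C[of 1] key by (meson order_refl zero_less_one)
  \<comment> \<open>Fatou speaks only of differences; \<open>l\<close> is recovered as
    \<open>f N - (f N - l)\<close>.\<close>
  then have "l \<in> L2 M"
    using L2_diff[OF f[of N] \<open>(\<lambda>x. f N x - l x) \<in> L2 M\<close>] by simp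
  moreover have "L2_tendsto M f l sequentially"
    unfolding L2_tendsto_def
  proof (rule LIMSEQ_I)
    fix e :: real assume "0 < e"
    then obtain N where "\<forall>m\<ge>N. \<forall>n\<ge>N. L2_norm M (\<lambda>x. f m x - f n x) < e / 2"
      using C[of "e / 2"] by auto
    with key[OF this] \<open>0 < e\<close> show "\<exists>N. \<forall>n\<ge>N. norm (L2_norm M (\<lambda>x. f n x - l x) - 0) < e"
      by (intro exI[of _ N]) force
  qed
  ultimately show ?thesis by blast
qed

lemma indicator_L2: "A \<in> sets M \<Longrightarrow> indicat_real A \<in> L2 M"
  by (auto simp: L2_def indicator_def intro!: integrable_const_bound[where B = 1])

lemma L2_tendsto_dominated:
  assumes [measurable]: "\<And>n. s n \<in> borel_measurable M" "f \<in> L2 M"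
    and w: "w \<in> L2 M" and lim: "\<And>x. x \<in> space M \<Longrightarrow> (\<lambda>n. s n x) \<longlonglongrightarrow> f x"
    and bound: "\<And>n x. x \<in> space M \<Longrightarrow> \<bar>s n x - f x\<bar> \<le> w x"
  shows "L2_tendsto M s f sequentially"
proof -
  have "(\<lambda>n. L2_inner M (\<lambda>x. s n x - f x) (\<lambda>x. s n x - f x)) \<longlonglongrightarrow> (LINT x|M. 0)"
    unfolding L2_inner_def
  proof (rule integral_dominated_convergence[where w = "\<lambda>x. w x * w x"])
    show "AE x in M. (\<lambda>n. (s n x - f x) * (s n x - f x)) \<longlonglongrightarrow> 0"
      using tendsto_mult_zero[OF LIM_zero[OF lim] LIM_zero[OF lim]] by auto
    show "AE x in M. norm ((s n x - f x) * (s n x - f x)) \<le> w x * w x" for n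
    proof (intro AE_I2)
      fix x assume x: "x \<in> space M"
      have "\<bar>s n x - f x\<bar> * \<bar>s n x - f x\<bar> \<le> w x * w x"
        using bound[OF x, of n] by (intro mult_mono) auto
      then show "norm ((s n x - f x) * (s n x - f x)) \<le> w x * w x" by simp
    qed
  qed (use w in \<open>auto intro: L2_mult_integrable\<close>)
  then have "(\<lambda>n. sqrt (L2_inner M (\<lambda>x. s n x - f x) (\<lambda>x. s n x - f x))) \<longlonglongrightarrow> sqrt 0"
    by (intro tendsto_real_sqrt) simp
  then show ?thesis by (simp add: L2_tendsto_def L2_norm_def)
qed

end

section \<open>Density of the continuous functions\<close>

locale metrizable_prob_space = prob_space M for M :: "'a::topological_space measure" +
  assumes metrizable: "metrizable_space (euclidean :: 'a topology)"
    and sets_borel: "sets M = sets borel"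
begin

lemma space_UNIV[simp]: "space M = UNIV"
  using sets_eq_imp_space_eq[OF sets_borel] by simp

lemma bcontfun_bounded_L2:
  assumes "continuous_on UNIV f" "\<And>x. \<bar>f x :: real\<bar> \<le> c"
  shows "f \<in> L2 M"
proof -
  have "f \<in> borel_measurable M"
    using borel_measurable_continuous_onI[OF assms(1)] sets_borel by (simp cong: measurable_cong_sets)
  moreover have "(f x)\<^sup>2 \<le> c\<^sup>2" for x
    using assms(2)[of x] by (metis abs_ge_zero power2_abs power_mono)
  ultimately show ?thesis
    by (auto simp: L2_def intro!: integrable_const_bound[where B = "c\<^sup>2"])
qed

lemma bcontfun_L2[simp]: "apply_bcontfun \<phi> \<in> L2 M" for \<phi> :: "'a \<Rightarrow>\<^sub>C real"
  using bcontfun_bounded_L2[of "apply_bcontfun \<phi>" "norm \<phi>"] norm_bounded[of \<phi>] by simp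

definition bcontfun_closure :: "('a \<Rightarrow> real) set" where
  "bcontfun_closure = {f \<in> L2 M. \<forall>e>0. \<exists>\<phi> :: 'a \<Rightarrow>\<^sub>C real. L2_norm M (\<lambda>x. \<phi> x - f x) < e}"

lemma bcontfun_closure_limit:
  assumes "f \<in> L2 M" "\<And>n. s n \<in> bcontfun_closure" "L2_tendsto M s f sequentially"
  shows "f \<in> bcontfun_closure"
  unfolding bcontfun_closure_def
proof (intro CollectI conjI allI impI assms(1))
  fix e :: real assume "0 < e"
  then have "\<forall>\<^sub>F n in sequentially. L2_norm M (\<lambda>x. s n x - f x) < e / 2"
    using assms(3) unfolding L2_tendsto_def by (intro order_tendstoD) auto
  then obtain n where n: "L2_norm M (\<lambda>x. s n x - f x) < e / 2"
    using eventually_happens'[OF sequentially_bot] by blast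
  obtain \<phi> :: "'a \<Rightarrow>\<^sub>C real" where "L2_norm M (\<lambda>x. \<phi> x - s n x) < e / 2"
    using assms(2)[of n] \<open>0 < e\<close> unfolding bcontfun_closure_def by (auto elim!: allE[of _ "e / 2"])
  with n show "\<exists>\<phi> :: 'a \<Rightarrow>\<^sub>C real. L2_norm M (\<lambda>x. \<phi> x - f x) < e"
    using L2_norm_diff_triangle[of \<phi> M "s n" f] assms(1,2)
    by (intro exI[of _ \<phi>]) (simp add: bcontfun_closure_def)
qed

lemma bcontfun_in_closure: "apply_bcontfun \<phi> \<in> bcontfun_closure" for \<phi> :: "'a \<Rightarrow>\<^sub>C real"
  by (auto simp: bcontfun_closure_def intro!: exI[of _ \<phi>])

lemma bcontfun_closure_scale:
  assumes "f \<in> bcontfun_closure"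
  shows "(\<lambda>x. c * f x) \<in> bcontfun_closure"
  unfolding bcontfun_closure_def
proof (intro CollectI conjI allI impI)
  show "(\<lambda>x. c * f x) \<in> L2 M" using assms by (simp add: bcontfun_closure_def)
  fix e :: real assume e: "0 < e"
  then obtain \<phi> :: "'a \<Rightarrow>\<^sub>C real" where \<phi>: "L2_norm M (\<lambda>x. \<phi> x - f x) < e / (\<bar>c\<bar> + 1)"
    using assms unfolding bcontfun_closure_def by (auto elim!: allE[of _ "e / (\<bar>c\<bar> + 1)"])
  have "L2_norm M (\<lambda>x. (c *\<^sub>R \<phi>) x - c * f x) = \<bar>c\<bar> * L2_norm M (\<lambda>x. \<phi> x - f x)"
    by (simp flip: L2_norm_scale right_diff_distrib)
  also have "\<dots> \<le> (\<bar>c\<bar> + 1) * L2_norm M (\<lambda>x. \<phi> x - f x)" by (intro mult_right_mono) auto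
  also have "\<dots> < e" using \<phi> by (simp add: field_simps)
  finally show "\<exists>\<phi> :: 'a \<Rightarrow>\<^sub>C real. L2_norm M (\<lambda>x. \<phi> x - c * f x) < e" by blast
qed

lemma bcontfun_closure_add:
  assumes "f \<in> bcontfun_closure" "g \<in> bcontfun_closure"
  shows "(\<lambda>x. f x + g x) \<in> bcontfun_closure"
  unfolding bcontfun_closure_def
proof (intro CollectI conjI allI impI)
  show "(\<lambda>x. f x + g x) \<in> L2 M" using assms by (simp add: bcontfun_closure_def)
  fix e :: real assume e: "0 < e"
  then obtain \<phi> \<psi> :: "'a \<Rightarrow>\<^sub>C real"
    where "L2_norm M (\<lambda>x. \<phi> x - f x) < e / 2" "L2_norm M (\<lambda>x. \<psi> x - g x) < e / 2"
    using assms unfolding bcontfun_closure_def by (auto elim!: allE[of _ "e / 2"])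
  then have "L2_norm M (\<lambda>x. (\<phi> + \<psi>) x - (f x + g x)) < e"
    using L2_norm_triangle[of "\<lambda>x. \<phi> x - f x" M "\<lambda>x. \<psi> x - g x"] assms
    by (simp add: bcontfun_closure_def algebra_simps)
  then show "\<exists>\<phi> :: 'a \<Rightarrow>\<^sub>C real. L2_norm M (\<lambda>x. \<phi> x - (f x + g x)) < e" by blast
qed

text \<open>Metrizability enters twice: \<open>F\<close> is a decreasing intersection of open sets
  \<open>U n\<close>, and normality gives Urysohn functions equal to 1 on \<open>F\<close> and 0 off
  \<open>U n\<close>. They converge pointwise to the indicator and stay between 0 and 1.\<close>

lemma indicator_closed_in_closure:
  assumes "closed F"
  shows "indicat_real F \<in> bcontfun_closure"
proof -
  obtain U where U: "\<And>n. open (U n)" "decseq U" "\<Inter>(range U) = F"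
    using closed_imp_gdelta_in[OF metrizable, of F] assms
    unfolding gdelta_in_descending by (auto simp: decseq_Suc_iff)
  have "\<exists>f. continuous_on UNIV f \<and> (\<forall>x. 0 \<le> f x \<and> f x \<le> 1) \<and>
      (\<forall>x\<in>F. f x = 1) \<and> (\<forall>x\<in>- U n. f x = (0::real))" for n
  proof -
    obtain f where f: "continuous_map (euclidean :: 'a topology) (top_of_set {0..1::real}) f"
        "f ` (- U n) \<subseteq> {0}" "f ` F \<subseteq> {1}"
    proof (rule Urysohn_lemma[of "euclidean :: 'a topology" "- U n" F 0 1])
      show "disjnt (- U n) F" using U(3) by (auto simp: disjnt_def)
    qed (use metrizable_imp_normal_space[OF metrizable] U(1) assms in \<open>auto simp: closed_def\<close>)
    then show ?thesis
      by (intro exI[of _ f]) (auto simp: continuous_map_in_subtopology image_subset_iff)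
  qed
  then obtain f where f: "\<And>n. continuous_on UNIV (f n)" "\<And>n x. 0 \<le> f n x" "\<And>n x. f n x \<le> 1"
    "\<And>n x. x \<in> F \<Longrightarrow> f n x = 1" "\<And>n x. x \<notin> U n \<Longrightarrow> f n x = (0::real)"
    by (metis ComplI)
  have bc: "f n \<in> bcontfun" for n
    using f by (intro bcontfun_normI[where b = 1]) auto
  have mem: "indicat_real F \<in> L2 M"
    using assms sets_borel by (intro indicator_L2) auto
  show ?thesis
  proof (rule bcontfun_closure_limit[OF mem])
    show "f n \<in> bcontfun_closure" for n
      using bcontfun_in_closure[of "Bcontfun (f n)"] bc by (simp add: Bcontfun_inverse)
    show "L2_tendsto M f (indicat_real F) sequentially"
    proof (rule L2_tendsto_dominated[OF _ mem L2_const[of 1]])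
      show "f n \<in> borel_measurable M" for n
        using borel_measurable_continuous_onI[OF f(1)] sets_borel by (simp cong: measurable_cong_sets)
      show "\<bar>f n x - indicat_real F x\<bar> \<le> 1" for n x
        using f(2,3)[of n x] by (auto simp: indicator_def)
      show "(\<lambda>n. f n x) \<longlonglongrightarrow> indicat_real F x" for x
      proof (cases "x \<in> F")
        case False
        then obtain N where "x \<notin> U N" using U(3) by blast
        then have "x \<notin> U n" if "n \<ge> N" for n using U(2) that by (auto simp: decseq_def)
        then have "\<forall>\<^sub>F n in sequentially. f n x = 0"
          unfolding eventually_sequentially using f(5) by blast
        with False show ?thesis by (simp add: tendsto_eventually)
      qed (simp add: f(4))
    qed
  qed
qed

text \<open>Dynkin's argument: the closed sets are stable under intersection and generate the Borel
  sets, while linearity and closedness under limits carry the property to complements and countable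
  disjoint unions.\<close>

lemma indicator_in_closure:
  assumes "A \<in> sets M"
  shows "indicat_real A \<in> bcontfun_closure"
proof -
  have "Int_stable (Collect closed :: 'a set set)" by (auto simp: Int_stable_def)
  moreover have "Collect closed \<subseteq> Pow (UNIV :: 'a set)" by simp
  moreover have "A \<in> sigma_sets UNIV (Collect closed)"
    using assms sets_borel by (simp add: borel_eq_closed)
  ultimately show ?thesis
  proof (induction rule: sigma_sets_induct_disjoint)
    case (basic A)
    then show ?case using indicator_closed_in_closure by simp
  next
    case empty
    show ?case by (rule indicator_closed_in_closure) simp
  next
    case (compl A)
    have "(\<lambda>x. indicat_real UNIV x + (-1) * indicat_real A x) \<in> bcontfun_closure"
      using indicator_closed_in_closure[of UNIV] compl
      by (intro bcontfun_closure_add bcontfun_closure_scale) simp_all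
    moreover have "(\<lambda>x. indicat_real UNIV x + (-1) * indicat_real A x) = indicat_real (UNIV - A)"
      by (auto simp: indicator_def)
    ultimately show ?case by simp
  next
    case (union A)
    have sets: "A i \<in> sets M" for i
      using union sets_borel by (auto simp: borel_eq_closed)
    have fin: "indicat_real (\<Union>i<n. A i) \<in> bcontfun_closure" for n
    proof (induction n)
      case 0
      show ?case using indicator_closed_in_closure[of "{}"]
        by (simp only: lessThan_0 UN_empty closed_empty)
    next
      case (Suc n)
      have "indicat_real (\<Union>i<Suc n. A i) = (\<lambda>x. indicat_real (\<Union>i<n. A i) x + indicat_real (A n) x)"
      proof
        fix x
        show "indicat_real (\<Union>i<Suc n. A i) x = indicat_real (\<Union>i<n. A i) x + indicat_real (A n) x"
        proof -
          have "x \<notin> A i" if "x \<in> A n" "i < n" for i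
            using union(1) that unfolding disjoint_family_on_def by (metis IntI UNIV_I emptyE less_irrefl)
          then show ?thesis by (auto simp: indicator_def lessThan_Suc)
        qed
      qed
      then show ?case using bcontfun_closure_add[OF Suc union(3)[of n]] by simp
    qed
    show ?case
    proof (rule bcontfun_closure_limit[OF _ fin])
      show "L2_tendsto M (\<lambda>n. indicat_real (\<Union>i<n. A i)) (indicat_real (\<Union>i. A i)) sequentially"
      proof (rule L2_tendsto_dominated[OF _ _ L2_const[of 1]])
        show "(\<lambda>n. indicat_real (\<Union>i<n. A i) x) \<longlonglongrightarrow> indicat_real (\<Union>i. A i) x" for x
          by (rule LIMSEQ_indicator_UN)
      qed (use sets in \<open>auto intro!: indicator_L2 borel_measurable_indicator simp: indicator_def\<close>)
    qed (use sets in \<open>auto intro!: indicator_L2\<close>)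
  qed
qed

lemma L2_subset_bcontfun_closure: "f \<in> L2 M \<Longrightarrow> f \<in> bcontfun_closure"
proof -
  assume f: "f \<in> L2 M"
  have simple: "s \<in> bcontfun_closure" if "simple_function M s" for s :: "'a \<Rightarrow> real"
  proof -
    have "emeasure M {y \<in> space M. s y \<noteq> 0} \<noteq> \<infinity>" by simp
    with that show ?thesis
    proof (induction rule: integrable_simple_function_induct)
      case (cong f g)
      then have "f = g" by auto
      with cong show ?case by simp
    next
      case (indicator A y)
      then show ?case using bcontfun_closure_scale[OF indicator_in_closure[of A], of y]
        by (simp add: mult.commute)
    next
      case (add f g)
      then show ?case by (intro bcontfun_closure_add)
    qed
  qed
  \<comment> \<open>Base point 0 in the approximation lemma gives
    \<open>\<bar>s i x\<bar> \<le> 2 * \<bar>f x\<bar>\<close>, whence the dominating function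
    \<open>3 * \<bar>f x\<bar>\<close> below.\<close>
  obtain s where s: "\<And>i. simple_function M (s i)" "\<And>x. (\<lambda>i. s i x) \<longlonglongrightarrow> f x"
    "\<And>i x. \<bar>s i x\<bar> \<le> 2 * \<bar>f x\<bar>"
    using borel_measurable_implies_sequence_metric[of f M 0] f by (auto simp: dist_norm)
  show ?thesis
  proof (rule bcontfun_closure_limit[OF f simple[OF s(1)]])
    show "L2_tendsto M s f sequentially"
    proof (rule L2_tendsto_dominated[where w = "\<lambda>x. 3 * \<bar>f x\<bar>"])
      show "(\<lambda>x. 3 * \<bar>f x\<bar>) \<in> L2 M" using f by (intro L2_scale) (auto simp: L2_def)
      show "\<bar>s n x - f x\<bar> \<le> 3 * \<bar>f x\<bar>" for n x using s(3)[of n x] by linarith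
    qed (use f s in \<open>auto intro: borel_measurable_simple_function\<close>)
  qed
qed

lemma bcontfun_dense:
  assumes "f \<in> L2 M" "0 < e"
  obtains \<phi> :: "'a \<Rightarrow>\<^sub>C real" where "L2_norm M (\<lambda>x. \<phi> x - f x) < e"
  using L2_subset_bcontfun_closure[OF assms(1)] assms(2) unfolding bcontfun_closure_def by blast

lemma bcontfun_dense_sequence:
  assumes "f \<in> L2 M"
  obtains \<phi> :: "nat \<Rightarrow> ('a \<Rightarrow>\<^sub>C real)" where "L2_tendsto M (\<lambda>k. apply_bcontfun (\<phi> k)) f sequentially"
proof -
  have "\<forall>k. \<exists>\<phi> :: 'a \<Rightarrow>\<^sub>C real. L2_norm M (\<lambda>x. \<phi> x - f x) < 1 / real (Suc k)"
    by (metis assms bcontfun_dense of_nat_0_less_iff zero_less_Suc zero_less_divide_1_iff)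
  then obtain \<phi> :: "nat \<Rightarrow> ('a \<Rightarrow>\<^sub>C real)" where "\<And>k. L2_norm M (\<lambda>x. \<phi> k x - f x) < 1 / real (Suc k)"
    by metis
  then have "L2_tendsto M (\<lambda>k. apply_bcontfun (\<phi> k)) f sequentially"
    unfolding L2_tendsto_def
    by (intro Lim_null_comparison[OF _ lim_1_over_n[THEN LIMSEQ_Suc]]) (auto intro!: always_eventually less_imp_le)
  with that show thesis .
qed

end

section \<open>Normal operators\<close>

text \<open>The Hilbert space part, free of semigroups. Linearity of \<open>A\<close> is required
  only up to \<open>L2_eq\<close>, as its values are chosen representatives. Density of
  \<open>D\<close> is put as a trivial orthogonal complement, the form in which it makes weak images
  unique.\<close>

locale normal_L2_operator = prob_space M for M :: "'a measure" +
  fixes D :: "('a \<Rightarrow> real) set" and A :: "('a \<Rightarrow> real) \<Rightarrow> ('a \<Rightarrow> real)"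
  assumes D_L2: "f \<in> D \<Longrightarrow> f \<in> L2 M"
    and A_L2: "f \<in> D \<Longrightarrow> A f \<in> L2 M"
    and D_add: "f \<in> D \<Longrightarrow> g \<in> D \<Longrightarrow> (\<lambda>x. f x + g x) \<in> D"
    and D_scale: "f \<in> D \<Longrightarrow> (\<lambda>x. c * f x) \<in> D"
    and A_add: "f \<in> D \<Longrightarrow> g \<in> D \<Longrightarrow> L2_eq M (A (\<lambda>x. f x + g x)) (\<lambda>x. A f x + A g x)"
    and A_scale: "f \<in> D \<Longrightarrow> L2_eq M (A (\<lambda>x. c * f x)) (\<lambda>x. c * A f x)"
    and D_dense: "w \<in> L2 M \<Longrightarrow> (\<And>f. f \<in> D \<Longrightarrow> L2_inner M f w = 0) \<Longrightarrow> L2_norm M w = 0"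
    and normal: "normal_operator M D A"
begin

abbreviation B :: "('a \<Rightarrow> real) \<Rightarrow> ('a \<Rightarrow> real)" where
  "B \<equiv> adj M D A"

lemma B_is_adj: "g \<in> D \<Longrightarrow> is_adj M D A g (B g)"
proof -
  assume "g \<in> D"
  then have "\<exists>h. is_adj M D A g h" using normal unfolding normal_operator_def adj_dom_def by blast
  then show ?thesis unfolding adj_def by (rule someI_ex)
qed

lemma B_L2: "g \<in> D \<Longrightarrow> B g \<in> L2 M"
  using B_is_adj by (simp add: is_adj_def)

lemma inner_A: "f \<in> D \<Longrightarrow> g \<in> D \<Longrightarrow> L2_inner M (A f) g = L2_inner M f (B g)"
  using B_is_adj by (simp add: is_adj_def)

lemma norm_B: "f \<in> D \<Longrightarrow> L2_norm M (B f) = L2_norm M (A f)"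
  using normal by (simp add: normal_operator_def)

lemmas mem = D_L2 A_L2 B_L2 D_add D_scale

text \<open>Normality makes \<open>D\<close> the domain of the adjoint, so a weak image
  \<open>h\<close> certifies membership. New elements of \<open>D\<close> are found this way,
  without any difference quotient.\<close>

lemma D_I:
  assumes "g \<in> L2 M" "h \<in> L2 M" "\<And>f. f \<in> D \<Longrightarrow> L2_inner M (A f) g = L2_inner M f h"
  shows "g \<in> D"
proof -
  have "is_adj M D A g h" using assms by (simp add: is_adj_def)
  then show ?thesis using assms normal unfolding normal_operator_def adj_dom_def by blast
qed

lemma L2_eq_dense:
  assumes "u \<in> L2 M" "v \<in> L2 M" "\<And>f. f \<in> D \<Longrightarrow> L2_inner M f u = L2_inner M f v"
  shows "L2_eq M u v"
  using assms D_dense[of "\<lambda>x. u x - v x"] by (simp add: L2_eq_def L2_inner_simps mem)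

text \<open>Inner products do not see the choice of representative, so \<open>B f\<close> is also a
  weak image of \<open>g\<close>.\<close>

lemma D_cong:
  assumes "f \<in> D" "L2_eq M f g"
  shows "g \<in> D"
proof (rule D_I[of g "B f"])
  fix h assume "h \<in> D"
  then show "L2_inner M (A h) g = L2_inner M h (B f)"
    using L2_inner_cong[OF L2_eq_refl assms(2), of "A h"] inner_A[OF _ assms(1)] by (simp add: mem)
qed (use assms in \<open>auto simp: L2_eq_def mem\<close>)

lemma A_cong:
  assumes "f \<in> D" "L2_eq M f g"
  shows "L2_eq M (A f) (A g)"
proof (rule L2_eq_dense)
  fix h assume h: "h \<in> D"
  have "L2_inner M (A f) h = L2_inner M (A g) h"
    using D_cong[OF assms] assms h by (simp add: inner_A L2_inner_cong[OF assms(2)] mem)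
  then show "L2_inner M h (A f) = L2_inner M h (A g)" by (metis L2_inner_commute)
qed (use D_cong[OF assms] assms in \<open>auto simp: mem\<close>)

lemma D_diff: "f \<in> D \<Longrightarrow> g \<in> D \<Longrightarrow> (\<lambda>x. f x - g x) \<in> D"
  using D_add[OF _ D_scale[of g "-1"], of f] by simp

lemma A_diff:
  assumes "f \<in> D" "g \<in> D"
  shows "L2_eq M (A (\<lambda>x. f x - g x)) (\<lambda>x. A f x - A g x)"
proof -
  have "L2_eq M (A (\<lambda>x. f x + (-1) * g x)) (\<lambda>x. A f x + A (\<lambda>x. (-1) * g x) x)"
    using assms by (intro A_add mem)
  also have "L2_eq M \<dots> (\<lambda>x. A f x + (-1) * A g x)"
    using assms by (intro L2_eq_add A_scale L2_eq_refl mem)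
  finally show ?thesis by simp
qed

lemma B_add: "f \<in> D \<Longrightarrow> g \<in> D \<Longrightarrow> L2_eq M (B (\<lambda>x. f x + g x)) (\<lambda>x. B f x + B g x)"
  by (rule L2_eq_dense) (simp_all add: mem L2_inner_simps flip: inner_A)

lemma B_diff: "f \<in> D \<Longrightarrow> g \<in> D \<Longrightarrow> L2_eq M (B (\<lambda>x. f x - g x)) (\<lambda>x. B f x - B g x)"
  by (rule L2_eq_dense) (simp_all add: mem D_diff L2_inner_simps flip: inner_A)

text \<open>Polarisation of the equality of norms; in a real space expanding the squares for
  \<open>f + g\<close> is enough.\<close>

lemma inner_A_A:
  assumes "f \<in> D" "g \<in> D"
  shows "L2_inner M (A f) (A g) = L2_inner M (B f) (B g)"
proof -
  have "L2_norm M (\<lambda>x. A f x + A g x) = L2_norm M (\<lambda>x. B f x + B g x)"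
    using norm_B[OF D_add[OF assms]] L2_norm_cong[OF A_add[OF assms]] L2_norm_cong[OF B_add[OF assms]] by simp
  then have "(L2_norm M (\<lambda>x. A f x + A g x))\<^sup>2 = (L2_norm M (\<lambda>x. B f x + B g x))\<^sup>2" by simp
  moreover have "(L2_norm M (A f))\<^sup>2 = (L2_norm M (B f))\<^sup>2" "(L2_norm M (A g))\<^sup>2 = (L2_norm M (B g))\<^sup>2"
    using assms by (simp_all add: norm_B)
  ultimately show ?thesis using assms
    by (simp add: L2_norm_square L2_inner_simps mem L2_inner_commute[of M "A g" "A f"] L2_inner_commute[of M "B g" "B f"])
qed

text \<open>Adjoints are closed, and by normality the graph norms of \<open>A\<close> and of its adjoint agree.\<close>

lemma A_closed:
  assumes f: "\<And>j. f j \<in> D" and "u \<in> L2 M" "k \<in> L2 M"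
    and u: "L2_tendsto M f u sequentially"
    and C: "\<And>e. 0 < e \<Longrightarrow> \<exists>N. \<forall>m\<ge>N. \<forall>n\<ge>N. L2_norm M (\<lambda>x. A (f m) x - A (f n) x) < e"
    and k: "L2_tendsto M (\<lambda>j. A (f j)) k sequentially"
  shows "u \<in> D" "L2_eq M (A u) k"
proof -
  have fL2: "f j \<in> L2 M" "A (f j) \<in> L2 M" "B (f j) \<in> L2 M" for j using f by (auto simp: mem)
  have "L2_norm M (\<lambda>x. B (f m) x - B (f n) x) = L2_norm M (\<lambda>x. A (f m) x - A (f n) x)" for m n
    using norm_B[OF D_diff[OF f f]] L2_norm_cong[OF A_diff[OF f f]] L2_norm_cong[OF B_diff[OF f f]] by metis
  then have CB: "\<exists>N. \<forall>m\<ge>N. \<forall>n\<ge>N. L2_norm M (\<lambda>x. B (f m) x - B (f n) x) < e" if "0 < e" for e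
    using C[OF that] by simp
  \<comment> \<open>Membership of \<open>u\<close> in the domain of the adjoint needs a limit of the
    \<open>B (f j)\<close>, although only the \<open>A (f j)\<close> are assumed to converge. Equal
    norms of differences make the former Cauchy as well.\<close>
  obtain l where l: "l \<in> L2 M" "L2_tendsto M (\<lambda>j. B (f j)) l sequentially"
    using L2_complete[OF fL2(3) CB] by blast
  show uD: "u \<in> D"
  proof (rule D_I[OF \<open>u \<in> L2 M\<close> l(1)])
    fix h assume h: "h \<in> D"
    have "(\<lambda>j. L2_inner M (f j) (A h)) \<longlonglongrightarrow> L2_inner M u (A h)"
      using fL2 u h by (intro L2_tendsto_inner assms) (auto simp: mem)
    moreover have "(\<lambda>j. L2_inner M (B (f j)) h) \<longlonglongrightarrow> L2_inner M l h"
      using fL2 l h by (intro L2_tendsto_inner) (auto simp: mem)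
    moreover have "L2_inner M (f j) (A h) = L2_inner M (B (f j)) h" for j
      using inner_A[OF h f] by (metis L2_inner_commute)
    ultimately show "L2_inner M (A h) u = L2_inner M h l"
      using LIMSEQ_unique by (simp add: L2_inner_commute[of M h l] L2_inner_commute[of M "A h" u])
  qed
  show "L2_eq M (A u) k"
  proof (rule L2_eq_dense)
    fix h assume h: "h \<in> D"
    have "(\<lambda>j. L2_inner M (f j) (B h)) \<longlonglongrightarrow> L2_inner M u (B h)"
      using fL2 u h by (intro L2_tendsto_inner assms) (auto simp: mem)
    moreover have "(\<lambda>j. L2_inner M (A (f j)) h) \<longlonglongrightarrow> L2_inner M k h"
      using fL2 k h assms by (intro L2_tendsto_inner) (auto simp: mem)
    ultimately have "L2_inner M u (B h) = L2_inner M k h"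
      using LIMSEQ_unique h f by (simp add: inner_A)
    then show "L2_inner M h (A u) = L2_inner M h k"
      using inner_A[OF uD h] by (simp add: L2_inner_commute[of M h k] L2_inner_commute[of M h "A u"])
  qed (use uD assms in \<open>auto simp: mem\<close>)
qed

text \<open>
  A minimising sequence is approximately orthogonal to the graph, and this passes to its limit.
\<close>

lemma graph_projection:
  assumes uk: "u \<in> L2 M" "k \<in> L2 M"
  obtains f where "f \<in> D"
    "\<And>h. h \<in> D \<Longrightarrow> L2_inner M (\<lambda>x. u x - f x) h + L2_inner M (\<lambda>x. k x - A f x) (A h) = 0"
proof -
  \<comment> \<open>Squared distance in the product space from \<open>(u, k)\<close> to the point
    \<open>(f, A f)\<close> of the graph.\<close>
  define q where "q f = (L2_norm M (\<lambda>x. u x - f x))\<^sup>2 + (L2_norm M (\<lambda>x. k x - A f x))\<^sup>2" for f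
  have zero: "(\<lambda>x. 0) \<in> D" using D_I[of "\<lambda>x. 0" "\<lambda>x. 0"] by (simp add: L2_inner_def)
  define m where "m = Inf (q ` D)"
  have bdd: "bdd_below (q ` D)" by (auto intro!: bdd_belowI[of _ 0] simp: q_def)
  have m_le: "m \<le> q f" if "f \<in> D" for f
    unfolding m_def using bdd that by (intro cInf_lower) auto
  have "\<exists>f\<in>D. q f < m + 1 / real (Suc j)" for j
    using cInf_lessD[of "q ` D" "m + 1 / real (Suc j)"] zero unfolding m_def by auto
  then obtain f where f: "\<And>j. f j \<in> D" "\<And>j. q (f j) < m + 1 / real (Suc j)" by metis
  have fL2: "f j \<in> L2 M" "A (f j) \<in> L2 M" for j using f by (auto simp: mem)
  \<comment> \<open>Along a line \<open>q\<close> is a quadratic polynomial in \<open>s\<close>. It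
    is used at \<open>s = 1\<close> and \<open>s = 1/2\<close> for the parallelogram law, and at all
    \<open>s\<close> for orthogonality.\<close>
  have q_line: "q (\<lambda>x. g x + s * h x) = q g
      + 2 * s * (- (L2_inner M (\<lambda>x. u x - g x) h + L2_inner M (\<lambda>x. k x - A g x) (A h)))
      + s\<^sup>2 * (L2_inner M h h + L2_inner M (A h) (A h))" if "g \<in> D" "h \<in> D" for g h s
  proof -
    have "L2_eq M (A (\<lambda>x. g x + s * h x)) (\<lambda>x. A g x + s * A h x)"
      using that by (intro L2_eq_trans[OF A_add] L2_eq_add L2_eq_refl A_scale) (auto simp: mem)
    then have "L2_norm M (\<lambda>x. k x - A (\<lambda>x. g x + s * h x) x) = L2_norm M (\<lambda>x. k x - (A g x + s * A h x))"
      using uk by (intro L2_norm_cong L2_eq_diff) auto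
    moreover have "(L2_norm M (\<lambda>x. v x - (a x + s * b x)))\<^sup>2 = (L2_norm M (\<lambda>x. v x - a x))\<^sup>2
        - 2 * s * L2_inner M (\<lambda>x. v x - a x) b + s\<^sup>2 * L2_inner M b b"
      if "v \<in> L2 M" "a \<in> L2 M" "b \<in> L2 M" for v a b
      unfolding L2_norm_square using that by (simp add: L2_inner_simps L2_inner_commute[of M b v]
          L2_inner_commute[of M b a] L2_inner_commute[of M a v] power2_eq_square algebra_simps)
    ultimately show ?thesis using that uk by (simp add: q_def mem algebra_simps)
  qed
  \<comment> \<open>Parallelogram law: \<open>q\<close> is at least \<open>m\<close> at the midpoint
    and exceeds \<open>m\<close> by less than \<open>1 / Suc i\<close> and \<open>1 / Suc j\<close>
    at the ends, which bounds the squared graph distance of the ends.\<close>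
  have dist: "L2_inner M (\<lambda>x. f i x - f j x) (\<lambda>x. f i x - f j x)
      + L2_inner M (\<lambda>x. A (f i) x - A (f j) x) (\<lambda>x. A (f i) x - A (f j) x)
      \<le> 2 / real (Suc i) + 2 / real (Suc j)" for i j
  proof -
    define h where "h = (\<lambda>x. f i x - f j x)"
    have h: "h \<in> D" unfolding h_def using f by (intro D_diff)
    have Ah: "L2_inner M (A h) (A h)
        = L2_inner M (\<lambda>x. A (f i) x - A (f j) x) (\<lambda>x. A (f i) x - A (f j) x)"
      unfolding h_def using f by (intro L2_inner_cong A_diff)
    have fi: "(\<lambda>x. f j x + 1 * h x) = f i" by (simp add: h_def)
    have "m \<le> q (\<lambda>x. f j x + 1 / 2 * h x)" using f h by (intro m_le mem)
    moreover define b where "b = L2_inner M (\<lambda>x. u x - f j x) h + L2_inner M (\<lambda>x. k x - A (f j) x) (A h)"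
    define c where "c = L2_inner M h h + L2_inner M (A h) (A h)"
    moreover have "q (f i) = q (f j) - 2 * b + c"
      using q_line[OF f(1) h, of j 1] unfolding fi b_def c_def by simp
    moreover have "q (\<lambda>x. f j x + 1 / 2 * h x) = q (f j) - b + c / 4"
      using q_line[OF f(1) h, of j "1/2"] unfolding b_def c_def by (simp add: power2_eq_square)
    moreover have "2 / real (Suc i) = 2 * (1 / real (Suc i))" "2 / real (Suc j) = 2 * (1 / real (Suc j))"
      by simp_all
    ultimately have "c \<le> 2 / real (Suc i) + 2 / real (Suc j)"
      using f(2)[of i] f(2)[of j] by linarith
    then show ?thesis unfolding c_def Ah by (simp add: h_def)
  qed
  have cauchy: "\<exists>N. \<forall>i\<ge>N. \<forall>j\<ge>N. L2_norm M (\<lambda>x. f i x - f j x) < e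
      \<and> L2_norm M (\<lambda>x. A (f i) x - A (f j) x) < e" if "0 < e" for e
  proof -
    \<comment> \<open>Both summands of \<open>dist\<close> are at most \<open>2 / Suc N\<close>, and
      their sum has to stay below \<open>e\<^sup>2\<close>.\<close>
    obtain N where N: "4 / e\<^sup>2 < real (Suc N)"
      using reals_Archimedean2[of "4 / e\<^sup>2"] less_trans[OF _ of_nat_less_iff[THEN iffD2, OF lessI]] by blast
    have sq: "t < e" if "0 \<le> t" "t\<^sup>2 \<le> 2 / real (Suc i) + 2 / real (Suc j)" "i \<ge> N" "j \<ge> N" for t i j
    proof (rule power2_less_imp_less)
      have "2 / real (Suc i) \<le> 2 / real (Suc N)" "2 / real (Suc j) \<le> 2 / real (Suc N)"
        using that by (auto intro!: divide_left_mono)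
      then have "t\<^sup>2 \<le> 4 / real (Suc N)" using that by linarith
      also have "\<dots> < e\<^sup>2" using N \<open>0 < e\<close> by (simp add: field_simps)
      finally show "t\<^sup>2 < e\<^sup>2" .
    qed (use \<open>0 < e\<close> in simp)
    show ?thesis
    proof (intro exI[of _ N] allI impI conjI)
      fix i j assume ij: "i \<ge> N" "j \<ge> N"
      show "L2_norm M (\<lambda>x. f i x - f j x) < e"
        using dist[of i j] L2_inner_self_nonneg[of M "\<lambda>x. A (f i) x - A (f j) x"]
        by (intro sq[OF _ _ ij] L2_norm_nonneg) (simp only: L2_norm_square)
      show "L2_norm M (\<lambda>x. A (f i) x - A (f j) x) < e"
        using dist[of i j] L2_inner_self_nonneg[of M "\<lambda>x. f i x - f j x"]
        by (intro sq[OF _ _ ij] L2_norm_nonneg) (simp only: L2_norm_square)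
    qed
  qed
  have cauchy1: "\<exists>N. \<forall>i\<ge>N. \<forall>j\<ge>N. L2_norm M (\<lambda>x. f i x - f j x) < e" if "0 < e" for e
    using cauchy[OF that] by blast
  have cauchy2: "\<exists>N. \<forall>i\<ge>N. \<forall>j\<ge>N. L2_norm M (\<lambda>x. A (f i) x - A (f j) x) < e" if "0 < e" for e
    using cauchy[OF that] by blast
  obtain f' where f': "f' \<in> L2 M" "L2_tendsto M f f' sequentially"
    using L2_complete[OF fL2(1) cauchy1] by blast
  obtain k' where k': "k' \<in> L2 M" "L2_tendsto M (\<lambda>j. A (f j)) k' sequentially"
    using L2_complete[OF fL2(2) cauchy2] by blast
  have f'D: "f' \<in> D" and Af': "L2_eq M (A f') k'"
    using A_closed[OF f(1) f'(1) k'(1) f'(2) cauchy2 k'(2)] by blast+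
  show thesis
  proof (rule that[OF f'D])
    fix h assume h: "h \<in> D"
    \<comment> \<open>\<open>-2 * b j\<close> is the slope of \<open>q\<close> at \<open>f j\<close>
      along \<open>h\<close>. Since \<open>q (f j)\<close> is within \<open>1 / Suc j\<close> of the
      infimum, the discriminant bounds \<open>(b j)\<^sup>2\<close> by
      \<open>c / Suc j\<close>.\<close>
    define b where "b j = L2_inner M (\<lambda>x. u x - f j x) h + L2_inner M (\<lambda>x. k x - A (f j) x) (A h)" for j
    define c where "c = L2_inner M h h + L2_inner M (A h) (A h)"
    have "(b j)\<^sup>2 \<le> 1 / real (Suc j) * c" for j
    proof -
      have "(- b j)\<^sup>2 \<le> 1 / real (Suc j) * c"
      proof (rule quadratic_nonneg_imp)
        fix s
        have "m \<le> q (\<lambda>x. f j x + s * h x)" using f h by (intro m_le mem)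
        then show "0 \<le> 1 / real (Suc j) + 2 * s * (- b j) + s\<^sup>2 * c"
          using q_line[OF f(1) h, of j s] f(2)[of j] unfolding b_def c_def by linarith
      qed
      then show ?thesis by simp
    qed
    moreover have lim: "(\<lambda>j. 1 / real (Suc j) * c) \<longlonglongrightarrow> 0"
      using LIMSEQ_Suc[OF lim_1_over_n] by (intro tendsto_mult_left_zero)
    ultimately have "(\<lambda>j. (b j)\<^sup>2) \<longlonglongrightarrow> 0"
      by (intro tendsto_sandwich[OF _ _ tendsto_const lim]) simp_all
    then have b0: "b \<longlonglongrightarrow> 0"
      using tendsto_real_sqrt by (fastforce simp: tendsto_rabs_zero_iff)
    have "b \<longlonglongrightarrow> (L2_inner M u h - L2_inner M f' h) + (L2_inner M k (A h) - L2_inner M k' (A h))"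
      unfolding b_def using h uk fL2 f' k'
      by (simp add: L2_inner_simps mem) (intro tendsto_intros L2_tendsto_inner; simp add: mem)
    with b0 have "(L2_inner M u h - L2_inner M f' h) + (L2_inner M k (A h) - L2_inner M k' (A h)) = 0"
      using LIMSEQ_unique by blast
    then show "L2_inner M (\<lambda>x. u x - f' x) h + L2_inner M (\<lambda>x. k x - A f' x) (A h) = 0"
      using h uk f'(1) f'D L2_inner_cong[OF Af' L2_eq_refl, of "A h"] by (simp add: L2_inner_simps mem)
  qed
qed

text \<open>
  The component \<open>(p, q)\<close> of \<open>(u, k)\<close> orthogonal to the graph of \<open>A\<close> satisfies both \<open>B q = - p\<close> and
  \<open>(B h, p) = (h, q)\<close>; for \<open>h = q\<close> this forces \<open>- (p, p) = (q, q)\<close>.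
\<close>

lemma adj_adj:
  assumes uk: "u \<in> L2 M" "k \<in> L2 M" and adj: "\<And>h. h \<in> D \<Longrightarrow> L2_inner M (B h) u = L2_inner M h k"
  shows "u \<in> D" "L2_eq M (A u) k"
proof -
  obtain f where f: "f \<in> D"
    "\<And>h. h \<in> D \<Longrightarrow> L2_inner M (\<lambda>x. u x - f x) h + L2_inner M (\<lambda>x. k x - A f x) (A h) = 0"
    using graph_projection[OF uk] by blast
  define p q where "p = (\<lambda>x. u x - f x)" and "q = (\<lambda>x. k x - A f x)"
  have pq: "p \<in> L2 M" "q \<in> L2 M" using uk f(1) by (auto simp: p_def q_def mem)
  have orth: "L2_inner M (A h) q = L2_inner M h (\<lambda>x. - p x)" if "h \<in> D" for h
    using f(2)[OF that] unfolding p_def[symmetric] q_def[symmetric]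
    by (simp add: L2_inner_simps L2_inner_commute[of M h p] L2_inner_commute[of M "A h" q])
  have qD: "q \<in> D" using orth pq by (intro D_I[of q "\<lambda>x. - p x"]) auto
  have "L2_eq M (B q) (\<lambda>x. - p x)"
    using pq qD orth by (intro L2_eq_dense) (auto simp: mem simp flip: inner_A)
  then have "L2_inner M (B q) p = - L2_inner M p p"
    using L2_inner_cong[OF _ L2_eq_refl[OF pq(1)]] by (metis L2_inner_uminus_left)
  moreover have "L2_inner M (B q) p = L2_inner M q q"
  proof -
    have "L2_inner M (B q) p = L2_inner M q k - L2_inner M q (A f)"
      unfolding p_def using qD uk f(1) adj[OF qD] inner_A[OF f(1) qD]
      by (simp add: L2_inner_diff_right mem L2_inner_commute[of M "B q" f] L2_inner_commute[of M q "A f"])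
    also have "\<dots> = L2_inner M q (\<lambda>x. k x - A f x)"
      using pq uk f(1) by (simp add: L2_inner_diff_right mem)
    finally show ?thesis by (simp add: q_def)
  qed
  ultimately have "L2_inner M p p = 0"
    using L2_inner_self_nonneg[of M p] L2_inner_self_nonneg[of M q] by linarith
  then have "L2_norm M p = 0" by (simp add: L2_norm_def)
  \<comment> \<open>The projection \<open>f\<close> equals \<open>u\<close> only almost everywhere;
    \<open>D_cong\<close> moves membership across.\<close>
  then have "L2_eq M f u"
    using uk f(1) L2_norm_minus_commute[of M f u] by (simp add: L2_eq_def p_def mem)
  then show uD: "u \<in> D" using D_cong f(1) by blast
  show "L2_eq M (A u) k"
    using uD uk adj inner_A[OF uD] by (intro L2_eq_dense) (metis mem L2_inner_commute)+
qed

text \<open>For \<open>h\<close> in \<open>D\<close>,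
  \<open>(B h, B f) = (A h, A f) = (h, B (A f))\<close>: so \<open>B f\<close> has the weak image
  \<open>B (A f)\<close> under the adjoint of \<open>B\<close>, and that adjoint is
  \<open>A\<close>.\<close>

lemma A_B_commute:
  assumes "f \<in> D" "A f \<in> D"
  shows "B f \<in> D" "L2_eq M (A (B f)) (B (A f))"
proof -
  have "L2_inner M (B h) (B f) = L2_inner M h (B (A f))" if "h \<in> D" for h
    using inner_A_A[OF that assms(1)] inner_A[OF that assms(2)] by simp
  then show "B f \<in> D" "L2_eq M (A (B f)) (B (A f))"
    using adj_adj[of "B f" "B (A f)"] assms by (auto simp: mem)
qed

section \<open>Iterated domains and their intersection\<close>

lemma pow_dom_cong: "f \<in> pow_dom M D A n \<Longrightarrow> L2_eq M f g \<Longrightarrow> g \<in> pow_dom M D A n"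
proof (induction n arbitrary: f g)
  case 0 then show ?case by (simp add: L2_eq_def)
next
  case (Suc n) then show ?case using D_cong A_cong by auto
qed

lemma pow_dom_add: "f \<in> pow_dom M D A n \<Longrightarrow> g \<in> pow_dom M D A n \<Longrightarrow> (\<lambda>x. f x + g x) \<in> pow_dom M D A n"
proof (induction n arbitrary: f g)
  case (Suc n)
  then show ?case using pow_dom_cong[OF Suc.IH L2_eq_sym[OF A_add]] by (auto simp: mem)
qed simp

lemma pow_dom_scale: "f \<in> pow_dom M D A n \<Longrightarrow> (\<lambda>x. c * f x) \<in> pow_dom M D A n"
proof (induction n arbitrary: f)
  case (Suc n)
  then show ?case using pow_dom_cong[OF Suc.IH L2_eq_sym[OF A_scale]] by (auto simp: mem)
qed simp

text \<open>Applying \<open>B\<close> costs one power: already \<open>B f \<in> D\<close> is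
  obtained from \<open>A f \<in> D\<close>. The induction goes through \<open>A f\<close>, replacing
  \<open>A (B f)\<close> by \<open>B (A f)\<close>. In the intersection \<open>V\<close> the loss
  disappears.\<close>

lemma pow_dom_B: "f \<in> pow_dom M D A (Suc n) \<Longrightarrow> B f \<in> pow_dom M D A n"
proof (induction n arbitrary: f)
  case 0 then show ?case by (simp add: mem)
next
  case (Suc n)
  then have "f \<in> D" "A f \<in> D" "B (A f) \<in> pow_dom M D A n" by auto
  then show ?case using A_B_commute[of f] pow_dom_cong[OF _ L2_eq_sym] by auto
qed

abbreviation V :: "('a \<Rightarrow> real) set" where "V \<equiv> inf_dom M D A"

lemma V_D: "f \<in> V \<Longrightarrow> f \<in> D"
  unfolding inf_dom_def using pow_dom.simps(2) by blast

lemma V_A: "f \<in> V \<Longrightarrow> A f \<in> V"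
  unfolding inf_dom_def using pow_dom.simps(2) by blast

lemma V_B: "f \<in> V \<Longrightarrow> B f \<in> V"
  unfolding inf_dom_def using pow_dom_B by blast

lemma V_add: "f \<in> V \<Longrightarrow> g \<in> V \<Longrightarrow> (\<lambda>x. f x + g x) \<in> V"
  unfolding inf_dom_def using pow_dom_add by blast

lemma V_scale: "f \<in> V \<Longrightarrow> (\<lambda>x. c * f x) \<in> V"
  unfolding inf_dom_def using pow_dom_scale by blast

end

section \<open>Energies\<close>

text \<open>What remains of the Markov semigroup at the level of its generator: constants are
  preserved, the mean is invariant by stationarity, and the semigroup contracts.\<close>

locale normal_markov_generator = normal_L2_operator +
  assumes one_D: "(\<lambda>_. 1) \<in> D" and A_one: "L2_norm M (A (\<lambda>_. 1)) = 0"
    and A_mean: "f \<in> D \<Longrightarrow> L2_inner M (A f) (\<lambda>_. 1) = 0"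
    and dissipative: "f \<in> D \<Longrightarrow> L2_inner M (A f) f \<le> 0"
begin

abbreviation E :: "nat \<Rightarrow> ('a \<Rightarrow> real) \<Rightarrow> ('a \<Rightarrow> real) \<Rightarrow> real" where
  "E \<equiv> energy M A"

text \<open>The factor \<open>(-1)\<close> is spelled out so that the rules for scaling apply as
  they stand.\<close>

definition dissip :: "('a \<Rightarrow> real) \<Rightarrow> ('a \<Rightarrow> real)" where
  "dissip f = (\<lambda>x. (-1) * (A f x + B f x))"

lemmas V_mem = V_D V_A V_B V_add V_scale mem

lemma V_dissip: "f \<in> V \<Longrightarrow> dissip f \<in> V"
  unfolding dissip_def by (intro V_mem)

text \<open>The adjoint moves to the constant: \<open>(1, B f) = (A 1, f)\<close>, and
  \<open>A 1\<close> has norm zero.\<close>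

lemma B_mean: "f \<in> D \<Longrightarrow> L2_inner M (B f) (\<lambda>_. 1) = 0"
  using inner_A[OF one_D, of f] L2_Cauchy_Schwarz[OF A_L2[OF one_D] D_L2, of f] A_one
  by (simp add: L2_inner_commute[of M "B f"])

lemma A_dissip_commute:
  assumes "f \<in> V"
  shows "L2_eq M (A (dissip f)) (dissip (A f))"
proof -
  have D: "A f \<in> D" "B f \<in> D" "f \<in> D" using assms by (auto intro: V_mem)
  have "L2_eq M (A (dissip f)) (\<lambda>x. (-1) * A (\<lambda>x. A f x + B f x) x)"
    unfolding dissip_def using D by (intro A_scale D_add)
  also have "L2_eq M \<dots> (\<lambda>x. (-1) * (A (A f) x + A (B f) x))"
    using D by (intro L2_eq_scale A_add)
  also have "L2_eq M \<dots> (\<lambda>x. (-1) * (A (A f) x + B (A f) x))"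
    using D by (intro L2_eq_scale L2_eq_add A_B_commute L2_eq_refl mem)
  finally show ?thesis by (simp add: dissip_def)
qed

lemma E_cong:
  "f \<in> V \<Longrightarrow> g \<in> V \<Longrightarrow> L2_eq M f f' \<Longrightarrow> L2_eq M g g' \<Longrightarrow> E n f g = E n f' g'"
proof (induction n arbitrary: f g f' g')
  case 0
  then show ?case
    using L2_inner_cong[of M f f' g g'] L2_inner_cong[of M f f' "\<lambda>_. 1" "\<lambda>_. 1"]
      L2_inner_cong[of M g g' "\<lambda>_. 1" "\<lambda>_. 1"] by simp
next
  case (Suc n)
  then have "E n (A f) g = E n (A f') g'" "E n f (A g) = E n f' (A g')"
    by (auto intro!: Suc.IH A_cong V_mem)
  then show ?case by simp
qed

lemma E_add_left:
  "f \<in> V \<Longrightarrow> g \<in> V \<Longrightarrow> h \<in> V \<Longrightarrow> E n (\<lambda>x. f x + g x) h = E n f h + E n g h"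
proof (induction n arbitrary: f g h)
  case 0
  then show ?case by (simp add: L2_inner_simps V_mem algebra_simps)
next
  case (Suc n)
  have "E n (A (\<lambda>x. f x + g x)) h = E n (\<lambda>x. A f x + A g x) h"
    using Suc.prems by (intro E_cong A_add L2_eq_refl) (auto intro!: V_mem)
  then show ?case using Suc by (simp add: V_mem)
qed

lemma E_scale_left: "f \<in> V \<Longrightarrow> h \<in> V \<Longrightarrow> E n (\<lambda>x. c * f x) h = c * E n f h"
proof (induction n arbitrary: f h)
  case 0
  then show ?case by (simp add: L2_inner_simps V_mem algebra_simps)
next
  case (Suc n)
  have "E n (A (\<lambda>x. c * f x)) h = E n (\<lambda>x. c * A f x) h"
    using Suc.prems by (intro E_cong A_scale L2_eq_refl) (auto intro!: V_mem)
  then show ?case using Suc by (simp add: V_mem algebra_simps)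
qed

lemma E_commute: "E n f g = E n g f"
proof (induction n arbitrary: f g)
  case 0
  show ?case using L2_inner_commute[of M f g] by simp
next
  case (Suc n)
  show ?case using Suc[of "A f" g] Suc[of f "A g"] by simp
qed

text \<open>For \<open>n = 0\<close> the adjoint turns \<open>(f, A g)\<close> into
  \<open>(B f, g)\<close>, and the products of means vanish by \<open>A_mean\<close> and
  \<open>B_mean\<close>. The induction step needs \<open>dissip (A f)\<close> in place of
  \<open>A (dissip f)\<close>, hence commutation.\<close>

lemma E_Suc: "f \<in> V \<Longrightarrow> g \<in> V \<Longrightarrow> E (Suc n) f g = E n (dissip f) g"
proof (induction n arbitrary: f g)
  case 0
  then have D: "f \<in> D" "g \<in> D" by (auto intro: V_mem)
  have "L2_inner M (dissip f) g = - L2_inner M (A f) g - L2_inner M f (A g)"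
    unfolding dissip_def using D inner_A[of g f]
    by (simp add: L2_inner_simps mem L2_inner_commute[of M f "A g"] L2_inner_commute[of M g "B f"])
  moreover have "L2_inner M (dissip f) (\<lambda>_. 1) = 0"
    unfolding dissip_def using D by (simp add: L2_inner_simps mem A_mean B_mean)
  ultimately show ?case using D by (simp add: A_mean)
next
  case (Suc n)
  have "E (Suc (Suc n)) f g = - E (Suc n) (A f) g - E (Suc n) f (A g)" by simp
  also have "\<dots> = - E n (dissip (A f)) g - E n (dissip f) (A g)"
    using Suc by (simp add: V_mem del: energy.simps)
  also have "E n (dissip (A f)) g = E n (A (dissip f)) g"
    using Suc.prems by (intro E_cong L2_eq_sym[OF A_dissip_commute] L2_eq_refl) (auto intro!: V_mem V_dissip)
  finally show ?case by simp
qed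

lemma E_Suc_Suc: "f \<in> V \<Longrightarrow> E (Suc (Suc n)) f f = E n (dissip f) (dissip f)"
  by (metis E_Suc E_commute V_dissip)

lemma E_nonneg: "f \<in> V \<Longrightarrow> 0 \<le> E n f f"
proof (induction n arbitrary: f rule: induct_nat_012)
  case 0
  have "(L2_inner M f (\<lambda>_. 1))\<^sup>2 \<le> (L2_norm M f * L2_norm M (\<lambda>_. 1))\<^sup>2"
    using 0 L2_Cauchy_Schwarz[of f M "\<lambda>_. 1"] by (intro power2_le_iff_abs_le[THEN iffD2]) (auto simp: V_mem)
  also have "\<dots> = L2_inner M f f"
    by (simp add: power_mult_distrib L2_norm_square) (simp add: L2_inner_def prob_space)
  finally show ?case by (simp add: power2_eq_square)
next
  case 1
  then show ?case
    using dissipative[of f] A_mean[of f] by (simp add: V_mem L2_inner_commute[of M f "A f"])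
next
  case (ge2 n)
  then show ?case by (simp add: E_Suc_Suc V_dissip del: energy.simps)
qed

lemma E_Cauchy_Schwarz:
  assumes "f \<in> V" "g \<in> V"
  shows "(E n f g)\<^sup>2 \<le> E n f f * E n g g"
proof (rule quadratic_nonneg_imp)
  fix s
  have "0 \<le> E n (\<lambda>x. f x + s * g x) (\<lambda>x. f x + s * g x)"
    using assms by (intro E_nonneg V_mem)
  also have "\<dots> = E n f f + 2 * s * E n f g + s\<^sup>2 * E n g g"
    using assms by (simp add: E_add_left E_scale_left V_mem E_commute[of n f "\<lambda>x. f x + s * g x"]
        E_commute[of n g "\<lambda>x. f x + s * g x"] E_commute[of n g f] power2_eq_square algebra_simps del: energy.simps)
  finally show "0 \<le> E n f f + 2 * s * E n f g + s\<^sup>2 * E n g g" .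
qed

lemma E_log_convex: "f \<in> V \<Longrightarrow> (E (Suc n) f f)\<^sup>2 \<le> E n f f * E (Suc (Suc n)) f f"
  using E_Cauchy_Schwarz[OF _ V_dissip, of f f n] E_Suc[of f f n] E_Suc_Suc[of f n] E_commute[of n f "dissip f"]
  by (simp del: energy.simps)

end

section \<open>The semigroup on square-integrable functions\<close>

text \<open>Jensen's inequality for the square. Positivity is applied to
  \<open>(\<phi> - c)\<^sup>2\<close> with the constant \<open>c\<close> frozen at the value of
  \<open>P \<phi>\<close> at the point \<open>x\<close>; at that point the image is
  \<open>P \<psi> x - c\<^sup>2\<close>.\<close>

lemma markov_operator_square_le:
  fixes \<phi> \<psi> :: "'a::topological_space \<Rightarrow>\<^sub>C real"
  assumes P: "markov_operator P" and \<psi>: "\<And>x. \<psi> x = (\<phi> x)\<^sup>2"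
  shows "(P \<phi> x)\<^sup>2 \<le> P \<psi> x"
proof -
  interpret P: bounded_linear P using P by (simp add: markov_operator_def)
  define c where "c = P \<phi> x"
  define \<theta> where "\<theta> = \<psi> - (2 * c) *\<^sub>R \<phi> + c\<^sup>2 *\<^sub>R const_bcontfun 1"
  have "0 \<le> \<theta> y" for y
  proof -
    have "\<theta> y = (\<phi> y - c)\<^sup>2"
      by (simp add: \<theta>_def \<psi> const_bcontfun.rep_eq power2_diff)
    then show ?thesis by simp
  qed
  then have "0 \<le> P \<theta> x" using P by (simp add: markov_operator_def)
  also have "P \<theta> = P \<psi> - (2 * c) *\<^sub>R P \<phi> + c\<^sup>2 *\<^sub>R const_bcontfun 1"
    using P by (simp add: \<theta>_def P.add P.diff P.scaleR markov_operator_def)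
  finally show ?thesis
    by (simp add: const_bcontfun.rep_eq c_def[symmetric]) (simp add: power2_eq_square)
qed

locale markov_L2 = metrizable_prob_space M for M :: "'a::topological_space measure" +
  fixes T :: "real \<Rightarrow> ('a \<Rightarrow>\<^sub>C real) \<Rightarrow> ('a \<Rightarrow>\<^sub>C real)"
  assumes semigroup: "markov_semigroup T"
    and stationary: "0 \<le> t \<Longrightarrow> (\<integral>x. apply_bcontfun (T t g) x \<partial>M) = (\<integral>x. apply_bcontfun g x \<partial>M)"
begin

lemma T_markov: "0 \<le> t \<Longrightarrow> markov_operator (T t)"
  using semigroup by (simp add: markov_semigroup_def)

lemma T_linear: "0 \<le> t \<Longrightarrow> bounded_linear (T t)"
  using T_markov by (simp add: markov_operator_def)

lemma T_zero: "T 0 \<phi> = \<phi>"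
  using semigroup by (simp add: markov_semigroup_def)

lemma T_add: "0 \<le> s \<Longrightarrow> 0 \<le> t \<Longrightarrow> T (s + t) \<phi> = T s (T t \<phi>)"
  using semigroup by (simp add: markov_semigroup_def)

lemma T_continuous: "continuous_on {0..} (\<lambda>t. T t \<phi>)"
  using semigroup by (simp add: markov_semigroup_def)

lemma bcontfun_integrable: "integrable M (apply_bcontfun \<phi>)" for \<phi> :: "'a \<Rightarrow>\<^sub>C real"
  using L2_mult_integrable[OF bcontfun_L2 L2_const[of 1]] by simp

lemma L2_norm_bcontfun_le: "L2_norm M (apply_bcontfun \<phi>) \<le> norm \<phi>" for \<phi> :: "'a \<Rightarrow>\<^sub>C real"
proof -
  have "L2_inner M \<phi> \<phi> \<le> (\<integral>x. (norm \<phi>)\<^sup>2 \<partial>M)"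
    unfolding L2_inner_def
  proof (rule integral_mono)
    show "apply_bcontfun \<phi> x * apply_bcontfun \<phi> x \<le> (norm \<phi>)\<^sup>2" for x
      using norm_bounded[of \<phi> x] power_mono[of "\<bar>\<phi> x\<bar>" "norm \<phi>" 2] by (simp add: power2_eq_square)
  qed (auto intro: L2_mult_integrable)
  then show ?thesis
    using prob_space by (simp add: L2_norm_def real_le_lsqrt)
qed

lemma bcontfun_L2_tendsto:
  fixes \<phi> :: "'b \<Rightarrow> 'a \<Rightarrow>\<^sub>C real"
  assumes "(\<phi> \<longlongrightarrow> \<psi>) F"
  shows "L2_tendsto M (\<lambda>i. apply_bcontfun (\<phi> i)) (apply_bcontfun \<psi>) F"
  unfolding L2_tendsto_def
proof (rule Lim_null_comparison)
  show "((\<lambda>i. norm (\<phi> i - \<psi>)) \<longlongrightarrow> 0) F"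
    using assms by (simp add: LIM_zero tendsto_norm_zero)
  show "\<forall>\<^sub>F i in F. norm (L2_norm M (\<lambda>x. \<phi> i x - \<psi> x)) \<le> norm (\<phi> i - \<psi>)"
    using L2_norm_bcontfun_le[of "\<phi> _ - \<psi>"] by (intro always_eventually) simp
qed

text \<open>The pointwise Jensen inequality is integrated, and stationarity removes
  \<open>T t\<close> from the integral of the square.\<close>

lemma T_L2_contraction:
  assumes "0 \<le> t"
  shows "L2_norm M (T t \<phi>) \<le> L2_norm M \<phi>"
proof -
  have "continuous_on UNIV (\<lambda>x. (\<phi> x)\<^sup>2)" by (intro continuous_intros) auto
  moreover have "norm ((\<phi> x)\<^sup>2) \<le> (norm \<phi>)\<^sup>2" for x
    using norm_bounded[of \<phi> x] power_mono[of "\<bar>\<phi> x\<bar>" "norm \<phi>" 2] by simp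
  ultimately have "(\<lambda>x. (\<phi> x)\<^sup>2) \<in> bcontfun" by (rule bcontfun_normI)
  then obtain \<psi> :: "'a \<Rightarrow>\<^sub>C real" where \<psi>: "\<And>x. \<psi> x = (\<phi> x)\<^sup>2"
    by (metis Bcontfun_inverse)
  have "L2_inner M (T t \<phi>) (T t \<phi>) \<le> (\<integral>x. T t \<psi> x \<partial>M)"
    unfolding L2_inner_def
    using markov_operator_square_le[OF T_markov[OF assms] \<psi>]
    by (intro integral_mono L2_mult_integrable bcontfun_L2 bcontfun_integrable) (simp add: power2_eq_square)
  also have "\<dots> = L2_inner M \<phi> \<phi>"
    using stationary[OF assms] by (simp add: \<psi> L2_inner_def power2_eq_square)
  finally show ?thesis by (simp add: L2_norm_def)
qed

lemma T_L2_diff_le: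
  assumes "0 \<le> t"
  shows "L2_norm M (\<lambda>x. T t \<phi> x - T t \<psi> x) \<le> L2_norm M (\<lambda>x. \<phi> x - \<psi> x)"
proof -
  interpret bounded_linear "T t" using T_linear[OF assms] .
  show ?thesis using T_L2_contraction[OF assms, of "\<phi> - \<psi>"] by (simp add: diff)
qed

abbreviation S :: "real \<Rightarrow> ('a \<Rightarrow> real) \<Rightarrow> ('a \<Rightarrow> real)" where
  "S \<equiv> L2_semigroup M T"

text \<open>The Hilbert choice in \<open>L2_ext\<close> has a witness: contraction keeps the images
  of an approximating sequence Cauchy.\<close>

lemma L2_ext_limit_exists:
  assumes t: "0 \<le> t" and f: "f \<in> L2 M"
  shows "\<exists>h. h \<in> L2 M \<and> (\<exists>\<phi> :: nat \<Rightarrow> ('a \<Rightarrow>\<^sub>C real).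
    L2_tendsto M (\<lambda>k. apply_bcontfun (\<phi> k)) f sequentially \<and>
    L2_tendsto M (\<lambda>k. apply_bcontfun (T t (\<phi> k))) h sequentially)"
proof -
  obtain \<phi> :: "nat \<Rightarrow> ('a \<Rightarrow>\<^sub>C real)" where \<phi>: "L2_tendsto M (\<lambda>k. apply_bcontfun (\<phi> k)) f sequentially"
    using bcontfun_dense_sequence[OF f] by blast
  have "\<exists>N. \<forall>m\<ge>N. \<forall>n\<ge>N. L2_norm M (\<lambda>x. T t (\<phi> m) x - T t (\<phi> n) x) < e" if "0 < e" for e
  proof -
    have "\<forall>\<^sub>F n in sequentially. L2_norm M (\<lambda>x. \<phi> n x - f x) < e / 2"
      using \<phi> that unfolding L2_tendsto_def by (intro order_tendstoD) auto
    then obtain N where N: "\<And>n. n \<ge> N \<Longrightarrow> L2_norm M (\<lambda>x. \<phi> n x - f x) < e / 2"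
      unfolding eventually_sequentially by blast
    have "L2_norm M (\<lambda>x. T t (\<phi> m) x - T t (\<phi> n) x) < e" if "m \<ge> N" "n \<ge> N" for m n
      using N[OF that(1)] N[OF that(2)] T_L2_diff_le[OF t, of "\<phi> m" "\<phi> n"]
        L2_norm_diff_triangle[of "\<phi> m" M f "\<phi> n"] L2_norm_minus_commute[of M f "\<phi> n"] f by simp
    then show ?thesis by blast
  qed
  note C = this
  obtain h where "h \<in> L2 M" "L2_tendsto M (\<lambda>k. apply_bcontfun (T t (\<phi> k))) h sequentially"
    using L2_complete[OF bcontfun_L2 C] by blast
  with \<phi> show ?thesis by blast
qed

lemma S_approx:
  assumes "0 \<le> t" "f \<in> L2 M"
  obtains \<phi> :: "nat \<Rightarrow> ('a \<Rightarrow>\<^sub>C real)" where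
    "L2_tendsto M (\<lambda>k. apply_bcontfun (\<phi> k)) f sequentially"
    "L2_tendsto M (\<lambda>k. apply_bcontfun (T t (\<phi> k))) (S t f) sequentially"
  using someI_ex[OF L2_ext_limit_exists[OF assms]] unfolding L2_semigroup_def L2_ext_def by blast

lemma S_L2: "0 \<le> t \<Longrightarrow> f \<in> L2 M \<Longrightarrow> S t f \<in> L2 M"
  using someI_ex[OF L2_ext_limit_exists] unfolding L2_semigroup_def L2_ext_def by blast

text \<open>Frees \<open>S\<close> from the sequence hidden in its definition: \<open>S t f\<close>
  is compared with \<open>T t \<psi>\<close> for an arbitrary continuous \<open>\<psi>\<close>. The
  algebraic laws of \<open>T\<close> reach \<open>S\<close> through this estimate and
  density.\<close>

lemma S_T_diff_le:
  assumes t: "0 \<le> t" and f: "f \<in> L2 M"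
  shows "L2_norm M (\<lambda>x. S t f x - T t \<psi> x) \<le> L2_norm M (\<lambda>x. f x - \<psi> x)"
proof -
  obtain \<phi> :: "nat \<Rightarrow> ('a \<Rightarrow>\<^sub>C real)" where \<phi>:
    "L2_tendsto M (\<lambda>k. apply_bcontfun (\<phi> k)) f sequentially"
    "L2_tendsto M (\<lambda>k. apply_bcontfun (T t (\<phi> k))) (S t f) sequentially"
    using S_approx[OF t f] .
  have lim: "L2_tendsto M (\<lambda>k x. h k x - \<theta> x) (\<lambda>x. h' x - \<theta> x) sequentially"
    if "L2_tendsto M h h' sequentially" for h h' and \<theta> :: "'a \<Rightarrow> real"
    using that by (simp add: L2_tendsto_def)
  show ?thesis
  proof (rule L2_tendsto_norm_le[OF _ _ lim[OF \<phi>(2)]])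
    show "(\<lambda>k. L2_norm M (\<lambda>x. \<phi> k x - \<psi> x)) \<longlonglongrightarrow> L2_norm M (\<lambda>x. f x - \<psi> x)"
      using f by (intro L2_tendsto_norm lim[OF \<phi>(1)]) auto
    show "\<forall>\<^sub>F k in sequentially. L2_norm M (\<lambda>x. T t (\<phi> k) x - T t \<psi> x) \<le> L2_norm M (\<lambda>x. \<phi> k x - \<psi> x)"
      using T_L2_diff_le[OF t] by simp
  qed (use S_L2[OF t f] in auto)
qed

lemma L2_eq_if_approx:
  assumes f: "f \<in> L2 M" and gh: "g \<in> L2 M" "h \<in> L2 M"
    and bound: "\<And>\<phi> :: 'a \<Rightarrow>\<^sub>C real. L2_norm M (\<lambda>x. g x - h x) \<le> c * L2_norm M (\<lambda>x. \<phi> x - f x)"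
  shows "L2_eq M g h"
proof -
  obtain \<phi> :: "nat \<Rightarrow> ('a \<Rightarrow>\<^sub>C real)" where \<phi>: "L2_tendsto M (\<lambda>k. apply_bcontfun (\<phi> k)) f sequentially"
    using bcontfun_dense_sequence[OF f] by blast
  have "(\<lambda>k. c * L2_norm M (\<lambda>x. \<phi> k x - f x)) \<longlonglongrightarrow> 0"
    using \<phi> unfolding L2_tendsto_def by (rule tendsto_mult_right_zero)
  then have "L2_norm M (\<lambda>x. g x - h x) \<le> 0"
    using bound by (intro LIMSEQ_le_const) auto
  then show ?thesis using gh by (auto simp: L2_eq_def intro: antisym)
qed

lemma S_bcontfun: "0 \<le> t \<Longrightarrow> L2_eq M (S t (apply_bcontfun \<phi>)) (T t \<phi>)"
  using S_T_diff_le[of t "apply_bcontfun \<phi>" \<phi>] S_L2[of t "apply_bcontfun \<phi>"] by (auto simp: L2_eq_def intro: antisym)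

lemma S_add:
  assumes t: "0 \<le> t" and fg: "f \<in> L2 M" "g \<in> L2 M"
  shows "L2_eq M (S t (\<lambda>x. f x + g x)) (\<lambda>x. S t f x + S t g x)"
proof -
  interpret bounded_linear "T t" using T_linear[OF t] .
  obtain \<phi> :: "nat \<Rightarrow> ('a \<Rightarrow>\<^sub>C real)" where \<phi>:
    "L2_tendsto M (\<lambda>k. apply_bcontfun (\<phi> k)) f sequentially"
    "L2_tendsto M (\<lambda>k. apply_bcontfun (T t (\<phi> k))) (S t f) sequentially"
    using S_approx[OF t fg(1)] .
  obtain \<psi> :: "nat \<Rightarrow> ('a \<Rightarrow>\<^sub>C real)" where \<psi>:
    "L2_tendsto M (\<lambda>k. apply_bcontfun (\<psi> k)) g sequentially"
    "L2_tendsto M (\<lambda>k. apply_bcontfun (T t (\<psi> k))) (S t g) sequentially"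
    using S_approx[OF t fg(2)] .
  let ?f = "\<lambda>x. f x + g x"
  have 1: "L2_tendsto M (\<lambda>k. apply_bcontfun (\<phi> k + \<psi> k)) ?f sequentially"
    using L2_tendsto_add[OF fg(1) _ \<phi>(1) fg(2) _ \<psi>(1)] by simp
  have 2: "L2_tendsto M (\<lambda>k. apply_bcontfun (T t (\<phi> k + \<psi> k))) (\<lambda>x. S t f x + S t g x) sequentially"
    using L2_tendsto_add[OF S_L2[OF t fg(1)] _ \<phi>(2) S_L2[OF t fg(2)] _ \<psi>(2)] by (simp add: add)
  \<comment> \<open>The choice behind \<open>S t ?f\<close> may rest on another sequence;
    \<open>S_T_diff_le\<close> shows that the sums serve just as well.\<close>
  have "L2_tendsto M (\<lambda>k. apply_bcontfun (T t (\<phi> k + \<psi> k))) (S t ?f) sequentially"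
    unfolding L2_tendsto_def
  proof (rule Lim_null_comparison)
    show "(\<lambda>k. L2_norm M (\<lambda>x. (\<phi> k + \<psi> k) x - ?f x)) \<longlonglongrightarrow> 0" using 1 unfolding L2_tendsto_def .
    show "\<forall>\<^sub>F k in sequentially. norm (L2_norm M (\<lambda>x. T t (\<phi> k + \<psi> k) x - S t ?f x))
        \<le> L2_norm M (\<lambda>x. (\<phi> k + \<psi> k) x - ?f x)"
      using S_T_diff_le[OF t, of ?f] fg
      by (intro always_eventually allI) (simp only: real_norm_def abs_of_nonneg L2_norm_nonneg
          L2_norm_minus_commute[of M "apply_bcontfun _"] L2_add)
  qed
  from L2_tendsto_unique[OF _ _ _ this 2] show ?thesis
    using S_L2[OF t] fg by auto
qed

lemma S_scale:
  assumes t: "0 \<le> t" and f: "f \<in> L2 M"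
  shows "L2_eq M (S t (\<lambda>x. c * f x)) (\<lambda>x. c * S t f x)"
proof (rule L2_eq_if_approx[OF f])
  interpret bounded_linear "T t" using T_linear[OF t] .
  fix \<phi> :: "'a \<Rightarrow>\<^sub>C real"
  have "L2_norm M (\<lambda>x. S t (\<lambda>x. c * f x) x - T t (c *\<^sub>R \<phi>) x) \<le> L2_norm M (\<lambda>x. c * f x - (c *\<^sub>R \<phi>) x)"
    using f by (intro S_T_diff_le t) auto
  also have "\<dots> = \<bar>c\<bar> * L2_norm M (\<lambda>x. f x - \<phi> x)"
    by (simp flip: L2_norm_scale right_diff_distrib)
  finally have 1: "L2_norm M (\<lambda>x. S t (\<lambda>x. c * f x) x - T t (c *\<^sub>R \<phi>) x) \<le> \<bar>c\<bar> * L2_norm M (\<lambda>x. \<phi> x - f x)"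
    by (simp only: L2_norm_minus_commute[of M f])
  have "L2_norm M (\<lambda>x. T t (c *\<^sub>R \<phi>) x - c * S t f x) = \<bar>c\<bar> * L2_norm M (\<lambda>x. T t \<phi> x - S t f x)"
    by (simp add: scaleR flip: L2_norm_scale right_diff_distrib)
  also have "\<dots> \<le> \<bar>c\<bar> * L2_norm M (\<lambda>x. \<phi> x - f x)"
    using S_T_diff_le[OF t f, of \<phi>]
    by (intro mult_left_mono) (simp_all add: L2_norm_minus_commute[of M f] L2_norm_minus_commute[of M "S t f"])
  finally show "L2_norm M (\<lambda>x. S t (\<lambda>x. c * f x) x - c * S t f x) \<le> 2 * \<bar>c\<bar> * L2_norm M (\<lambda>x. \<phi> x - f x)"
    using 1 L2_norm_diff_triangle[of "S t (\<lambda>x. c * f x)" M "T t (c *\<^sub>R \<phi>)" "\<lambda>x. c * S t f x"] f S_L2[OF t]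
    by simp
qed (use f S_L2[OF t] in auto)

lemma S_contraction:
  assumes t: "0 \<le> t" and f: "f \<in> L2 M"
  shows "L2_norm M (S t f) \<le> L2_norm M f"
proof -
  have "L2_norm M (\<lambda>x. S t f x - T t 0 x) \<le> L2_norm M (\<lambda>x. f x - (0 :: 'a \<Rightarrow>\<^sub>C real) x)"
    by (rule S_T_diff_le[OF assms])
  moreover have "T t 0 = 0" using T_linear[OF t] linear_0 bounded_linear.linear by blast
  ultimately show ?thesis by simp
qed

lemma S_diff:
  assumes t: "0 \<le> t" and fg: "f \<in> L2 M" "g \<in> L2 M"
  shows "L2_eq M (S t (\<lambda>x. f x - g x)) (\<lambda>x. S t f x - S t g x)"
proof -
  have "L2_eq M (S t (\<lambda>x. f x + (-1) * g x)) (\<lambda>x. S t f x + S t (\<lambda>x. (-1) * g x) x)"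
    using assms by (intro S_add L2_scale)
  also have "L2_eq M \<dots> (\<lambda>x. S t f x + (-1) * S t g x)"
    using assms by (intro L2_eq_add S_scale L2_eq_refl S_L2)
  finally show ?thesis by simp
qed

lemma S_diff_le:
  assumes t: "0 \<le> t" and fg: "f \<in> L2 M" "g \<in> L2 M"
  shows "L2_norm M (\<lambda>x. S t f x - S t g x) \<le> L2_norm M (\<lambda>x. f x - g x)"
  using S_contraction[OF t L2_diff[OF fg]] L2_norm_cong[OF S_diff[OF assms]] by simp

lemma S_divide: "0 \<le> t \<Longrightarrow> f \<in> L2 M \<Longrightarrow> L2_eq M (S t (\<lambda>x. f x / c)) (\<lambda>x. S t f x / c)"
  using S_scale[of t f "1/c"] by simp

lemma S_semigroup:
  assumes st: "0 \<le> s" "0 \<le> t" and f: "f \<in> L2 M"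
  shows "L2_eq M (S (s + t) f) (S s (S t f))"
proof (rule L2_eq_if_approx[OF f])
  fix \<phi> :: "'a \<Rightarrow>\<^sub>C real"
  have "L2_norm M (\<lambda>x. S (s + t) f x - T (s + t) \<phi> x) \<le> L2_norm M (\<lambda>x. f x - \<phi> x)"
    using st by (intro S_T_diff_le f) auto
  moreover have "L2_norm M (\<lambda>x. S s (S t f) x - T s (T t \<phi>) x) \<le> L2_norm M (\<lambda>x. S t f x - T t \<phi> x)"
    using st f by (intro S_T_diff_le S_L2) auto
  moreover have "L2_norm M (\<lambda>x. S t f x - T t \<phi> x) \<le> L2_norm M (\<lambda>x. f x - \<phi> x)"
    using st by (intro S_T_diff_le f) auto
  ultimately show "L2_norm M (\<lambda>x. S (s + t) f x - S s (S t f) x) \<le> 2 * L2_norm M (\<lambda>x. \<phi> x - f x)"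
    using L2_norm_diff_triangle[of "S (s + t) f" M "T (s + t) \<phi>" "S s (S t f)"] st f S_L2
      L2_norm_minus_commute[of M f \<phi>] L2_norm_minus_commute[of M "S s (S t f)" "T s (T t \<phi>)"]
    by (simp add: T_add)
qed (use assms S_L2 in auto)

lemma S_mean:
  assumes t: "0 \<le> t" and f: "f \<in> L2 M"
  shows "L2_inner M (S t f) (\<lambda>_. 1) = L2_inner M f (\<lambda>_. 1)"
proof -
  obtain \<phi> :: "nat \<Rightarrow> ('a \<Rightarrow>\<^sub>C real)" where \<phi>:
    "L2_tendsto M (\<lambda>k. apply_bcontfun (\<phi> k)) f sequentially"
    "L2_tendsto M (\<lambda>k. apply_bcontfun (T t (\<phi> k))) (S t f) sequentially"
    using S_approx[OF t f] .
  have "(\<lambda>k. L2_inner M (\<phi> k) (\<lambda>_. 1)) \<longlonglongrightarrow> L2_inner M f (\<lambda>_. 1)"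
    using f \<phi> by (intro L2_tendsto_inner) auto
  moreover have "(\<lambda>k. L2_inner M (T t (\<phi> k)) (\<lambda>_. 1)) \<longlonglongrightarrow> L2_inner M (S t f) (\<lambda>_. 1)"
    using f \<phi> S_L2[OF t f] by (intro L2_tendsto_inner) auto
  moreover have "L2_inner M (T t (\<phi> k)) (\<lambda>_. 1) = L2_inner M (\<phi> k) (\<lambda>_. 1)" for k
    using stationary[OF t] by (simp add: L2_inner_def)
  ultimately show ?thesis using LIMSEQ_unique by simp
qed

text \<open>Contraction is uniform in time, so one continuous \<open>\<phi>\<close> close to
  \<open>f\<close> serves all \<open>s\<close>. The three errors of \<open>e / 3\<close> are the
  approximation at \<open>s\<close>, the motion of \<open>T s \<phi>\<close>, and the approximation
  at \<open>t\<close>.\<close>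

lemma S_continuous:
  assumes t: "0 \<le> t" and f: "f \<in> L2 M"
  shows "L2_tendsto M (\<lambda>s. S s f) (S t f) (at t within {0..})"
  unfolding L2_tendsto_def
proof (rule tendstoI)
  fix e :: real assume "0 < e"
  then obtain \<phi> :: "'a \<Rightarrow>\<^sub>C real" where \<phi>: "L2_norm M (\<lambda>x. \<phi> x - f x) < e / 3"
    using bcontfun_dense[OF f, of "e / 3"] by auto
  have "((\<lambda>s. T s \<phi>) \<longlongrightarrow> T t \<phi>) (at t within {0..})"
    using T_continuous t by (simp add: continuous_on_def)
  then have "\<forall>\<^sub>F s in at t within {0..}. L2_norm M (\<lambda>x. T s \<phi> x - T t \<phi> x) < e / 3"
    using bcontfun_L2_tendsto \<open>0 < e\<close> unfolding L2_tendsto_def by (intro order_tendstoD) auto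
  moreover have "\<forall>\<^sub>F s in at t within {0..}. s \<in> {0..}"
    by (simp add: eventually_at_filter)
  ultimately show "\<forall>\<^sub>F s in at t within {0..}. dist (L2_norm M (\<lambda>x. S s f x - S t f x)) 0 < e"
  proof eventually_elim
    case (elim s)
    then have s: "0 \<le> s" by simp
    have "L2_norm M (\<lambda>x. S s f x - S t f x)
      \<le> L2_norm M (\<lambda>x. S s f x - T s \<phi> x) + L2_norm M (\<lambda>x. T s \<phi> x - T t \<phi> x) + L2_norm M (\<lambda>x. T t \<phi> x - S t f x)"
      using L2_norm_diff_triangle[of "S s f" M "T s \<phi>" "S t f"] L2_norm_diff_triangle[of "T s \<phi>" M "T t \<phi>" "S t f"]
        S_L2[OF s f] S_L2[OF t f] by simp
    then show ?case
      using elim S_T_diff_le[OF s f, of \<phi>] S_T_diff_le[OF t f, of \<phi>] \<phi>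
        L2_norm_minus_commute[of M f \<phi>] L2_norm_minus_commute[of M "S t f" "T t \<phi>"] by simp
  qed
qed

end

text \<open>
  The library has completeness only over metric domains; here it is needed to integrate curves of
  continuous functions on a space that is merely metrizable.
\<close>

instance bcontfun :: (topological_space, complete_space) complete_space
proof
  fix f :: "nat \<Rightarrow> ('a, 'b) bcontfun"
  assume C: "Cauchy f"
  then have "uniformly_Cauchy_on UNIV (\<lambda>n. apply_bcontfun (f n))"
    unfolding uniformly_Cauchy_on_def
    using dist_fun_lt_imp_dist_val_lt by (metis Cauchy_def C)
  then obtain g where g: "uniform_limit UNIV (\<lambda>n. apply_bcontfun (f n)) g sequentially"
    using Cauchy_uniformly_convergent uniformly_convergent_on_def by blast
  from uniform_limit_bcontfunE[OF g] show "convergent f"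
    by (metis convergentI trivial_limit_sequentially)
qed

instance bcontfun :: (topological_space, banach) banach ..

section \<open>The generator\<close>

text \<open>Recasts a right derivative as the quotient at \<open>0\<close> used in
  \<open>generates\<close>; it is applied to integrals of orbits at their endpoints.\<close>

lemma has_vector_derivative_at_right_quotient:
  fixes u :: "real \<Rightarrow> 'a::real_normed_vector"
  assumes "(u has_vector_derivative v) (at_right r)"
  shows "((\<lambda>t. (1 / t) *\<^sub>R (u (r + t) - u r)) \<longlongrightarrow> v) (at_right 0)"
proof -
  have "((\<lambda>y. (1 / norm (y - r)) *\<^sub>R (u y - (u r + (y - r) *\<^sub>R v))) \<longlongrightarrow> 0) (at_right r)"
    using assms by (simp add: has_vector_derivative_def has_derivative_within)
  then have "((\<lambda>t. (1 / \<bar>t\<bar>) *\<^sub>R (u (t + r) - (u r + t *\<^sub>R v))) \<longlongrightarrow> 0) (at_right 0)"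
    by (subst (asm) filterlim_at_right_to_0) simp
  then have "((\<lambda>t. (1 / \<bar>t\<bar>) *\<^sub>R (u (t + r) - (u r + t *\<^sub>R v)) + v) \<longlongrightarrow> 0 + v) (at_right 0)"
    by (intro tendsto_intros)
  moreover have "\<forall>\<^sub>F t in at_right 0. (1 / \<bar>t\<bar>) *\<^sub>R (u (t + r) - (u r + t *\<^sub>R v)) + v
      = (1 / t) *\<^sub>R (u (r + t) - u r)"
    using eventually_at_right_less[of "0::real"]
    by eventually_elim (simp add: scaleR_diff_right scaleR_add_right add.commute)
  ultimately have "((\<lambda>t. (1 / t) *\<^sub>R (u (r + t) - u r)) \<longlongrightarrow> 0 + v) (at_right 0)"
    by (rule Lim_transform_eventually)
  then show ?thesis by simp
qed

context markov_L2
begin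

abbreviation D :: "('a \<Rightarrow> real) set" where "D \<equiv> gen_dom M S"
abbreviation A :: "('a \<Rightarrow> real) \<Rightarrow> ('a \<Rightarrow> real)" where "A \<equiv> gen M S"

lemma D_L2: "f \<in> D \<Longrightarrow> f \<in> L2 M"
  by (simp add: gen_dom_def)

lemma generates_A: "f \<in> D \<Longrightarrow> generates M S f (A f)"
  unfolding gen_dom_def gen_def mem_Collect_eq using someI_ex by metis

lemma A_L2: "f \<in> D \<Longrightarrow> A f \<in> L2 M"
  using generates_A by (simp add: generates_def)

lemma A_tendsto: "f \<in> D \<Longrightarrow> L2_tendsto M (\<lambda>t x. (S t f x - f x) / t) (A f) (at_right 0)"
  using generates_A by (simp add: generates_def)

text \<open>Membership is only eventual, because nothing is known about \<open>S t\<close> for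
  negative \<open>t\<close>.\<close>

lemma quotient_L2: "f \<in> L2 M \<Longrightarrow> \<forall>\<^sub>F t in at_right 0. (\<lambda>x. (S t f x - f x) / t) \<in> L2 M"
  using eventually_at_right_less[of "0::real"] by eventually_elim (intro L2_divide L2_diff S_L2; simp)

lemma D_A_I:
  assumes "f \<in> L2 M" "generates M S f h"
  shows "f \<in> D" "L2_eq M (A f) h"
proof -
  show f: "f \<in> D" using assms by (auto simp: gen_dom_def)
  show "L2_eq M (A f) h"
    using L2_tendsto_unique[OF A_L2[OF f] _ quotient_L2[OF assms(1)] A_tendsto[OF f]] assms(2)
    by (simp add: generates_def trivial_limit_at_right_real)
qed

lemma generates_add:
  assumes "f \<in> D" "g \<in> D"
  shows "generates M S (\<lambda>x. f x + g x) (\<lambda>x. A f x + A g x)"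
  unfolding generates_def
proof
  have fg: "f \<in> L2 M" "g \<in> L2 M" using assms by (auto intro: D_L2)
  show "(\<lambda>x. A f x + A g x) \<in> L2 M" using assms by (intro L2_add A_L2)
  show "L2_tendsto M (\<lambda>t x. (S t (\<lambda>x. f x + g x) x - (f x + g x)) / t) (\<lambda>x. A f x + A g x) (at_right 0)"
  proof (rule L2_tendsto_cong[OF L2_eq_refl])
    show "L2_tendsto M (\<lambda>t x. (S t f x - f x) / t + (S t g x - g x) / t) (\<lambda>x. A f x + A g x) (at_right 0)"
      using assms fg by (intro L2_tendsto_add A_L2 A_tendsto quotient_L2)
    show "\<forall>\<^sub>F t in at_right 0. L2_eq M (\<lambda>x. (S t f x - f x) / t + (S t g x - g x) / t)
        (\<lambda>x. (S t (\<lambda>x. f x + g x) x - (f x + g x)) / t)"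
      using eventually_at_right_less[of "0::real"]
    proof eventually_elim
      case (elim t)
      have "L2_eq M (\<lambda>x. ((S t f x + S t g x) - (f x + g x)) / t) (\<lambda>x. (S t (\<lambda>x. f x + g x) x - (f x + g x)) / t)"
        using elim fg by (intro L2_eq_divide L2_eq_diff L2_eq_sym[OF S_add]) auto
      then show ?case by (simp add: add_divide_distrib diff_divide_distrib algebra_simps)
    qed
  qed (use assms A_L2 in auto)
qed

lemma generates_scale:
  assumes "f \<in> D"
  shows "generates M S (\<lambda>x. c * f x) (\<lambda>x. c * A f x)"
  unfolding generates_def
proof
  have f: "f \<in> L2 M" using assms by (rule D_L2)
  show "(\<lambda>x. c * A f x) \<in> L2 M" using assms by (intro L2_scale A_L2)
  show "L2_tendsto M (\<lambda>t x. (S t (\<lambda>x. c * f x) x - c * f x) / t) (\<lambda>x. c * A f x) (at_right 0)"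
  proof (rule L2_tendsto_cong[OF L2_eq_refl])
    show "L2_tendsto M (\<lambda>t x. c * ((S t f x - f x) / t)) (\<lambda>x. c * A f x) (at_right 0)"
      using assms by (intro L2_tendsto_scale A_tendsto)
    show "\<forall>\<^sub>F t in at_right 0. L2_eq M (\<lambda>x. c * ((S t f x - f x) / t))
        (\<lambda>x. (S t (\<lambda>x. c * f x) x - c * f x) / t)"
      using eventually_at_right_less[of "0::real"]
    proof eventually_elim
      case (elim t)
      have "L2_eq M (\<lambda>x. (c * S t f x - c * f x) / t) (\<lambda>x. (S t (\<lambda>x. c * f x) x - c * f x) / t)"
        using elim f by (intro L2_eq_divide L2_eq_diff L2_eq_sym[OF S_scale]) auto
      then show ?case by (simp add: right_diff_distrib diff_divide_distrib)
    qed
  qed (use assms A_L2 in auto)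
qed

lemma one_D: "(\<lambda>_. 1) \<in> D" and A_one: "L2_norm M (A (\<lambda>_. 1)) = 0"
proof -
  have "generates M S (\<lambda>_. 1) (\<lambda>_. 0)"
    unfolding generates_def
  proof
    show "L2_tendsto M (\<lambda>t x. (S t (\<lambda>_. 1) x - 1) / t) (\<lambda>_. 0) (at_right 0)"
    proof (rule L2_tendsto_cong[OF L2_eq_refl _ L2_tendsto_const])
      show "\<forall>\<^sub>F t in at_right 0. L2_eq M (\<lambda>_. 0) (\<lambda>x. (S t (\<lambda>_. 1) x - 1) / t)"
        using eventually_at_right_less[of "0::real"]
      proof eventually_elim
        case (elim t)
        have "L2_eq M (S t (apply_bcontfun (const_bcontfun 1))) (T t (const_bcontfun 1))"
          using elim by (intro S_bcontfun) auto
        then have "L2_eq M (S t (\<lambda>_. 1)) (\<lambda>_. 1)"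
          using T_markov[of t] elim by (simp add: markov_operator_def const_bcontfun.rep_eq)
        then have "L2_eq M (\<lambda>x. (S t (\<lambda>_. 1) x - 1) / t) (\<lambda>x. (1 - 1) / t)"
          by (intro L2_eq_divide L2_eq_diff L2_eq_refl L2_const)
        then show ?case using L2_eq_sym by simp
      qed
    qed simp
  qed simp
  from D_A_I[OF L2_const this] show "(\<lambda>_. 1) \<in> D" "L2_norm M (A (\<lambda>_. 1)) = 0"
    by (auto simp: L2_eq_def)
qed

lemma A_mean:
  assumes "f \<in> D"
  shows "L2_inner M (A f) (\<lambda>_. 1) = 0"
proof -
  have f: "f \<in> L2 M" using assms by (rule D_L2)
  have "((\<lambda>t. L2_inner M (\<lambda>x. (S t f x - f x) / t) (\<lambda>_. 1)) \<longlongrightarrow> L2_inner M (A f) (\<lambda>_. 1)) (at_right 0)"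
    by (intro L2_tendsto_inner A_L2 A_tendsto quotient_L2 assms f L2_const)
  moreover have "\<forall>\<^sub>F t in at_right 0. L2_inner M (\<lambda>x. (S t f x - f x) / t) (\<lambda>_. 1) = 0"
    using eventually_at_right_less[of "0::real"]
    by eventually_elim (simp add: L2_inner_simps S_L2 S_mean f)
  ultimately have "((\<lambda>t::real. 0) \<longlongrightarrow> L2_inner M (A f) (\<lambda>_. 1)) (at_right 0)"
    by (rule Lim_transform_eventually)
  then show ?thesis
    using tendsto_unique[OF trivial_limit_at_right_real _ tendsto_const] by metis
qed

lemma dissipative:
  assumes "f \<in> D"
  shows "L2_inner M (A f) f \<le> 0"
proof (rule tendsto_upperbound)
  have f: "f \<in> L2 M" using assms by (rule D_L2)
  show "((\<lambda>t. L2_inner M (\<lambda>x. (S t f x - f x) / t) f) \<longlongrightarrow> L2_inner M (A f) f) (at_right 0)"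
    by (intro L2_tendsto_inner A_L2 A_tendsto quotient_L2 assms f)
  show "\<forall>\<^sub>F t in at_right 0. L2_inner M (\<lambda>x. (S t f x - f x) / t) f \<le> 0"
    using eventually_at_right_less[of "0::real"]
  proof eventually_elim
    case (elim t)
    have "L2_inner M (S t f) f \<le> L2_norm M (S t f) * L2_norm M f"
      using L2_Cauchy_Schwarz[of "S t f" M f] S_L2[of t f] f elim by simp
    also have "\<dots> \<le> L2_norm M f * L2_norm M f"
      using S_contraction[of t f] f elim by (intro mult_right_mono) auto
    also have "\<dots> = L2_inner M f f" by (simp flip: L2_norm_square power2_eq_square)
    finally show ?case
      using elim f S_L2[of t f] by (simp add: L2_inner_simps divide_nonpos_pos)
  qed
qed (rule trivial_limit_at_right_real)

text \<open>Pulling out \<open>S\<close> at the earlier time reduces a two-sided quotient to the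
  right quotient at \<open>0\<close>, so increments of both signs are handled together. The second
  summand pays for replacing the earlier time by \<open>t\<close>.\<close>

lemma S_quotient_bound:
  assumes f: "f \<in> D" and st: "0 \<le> s" "0 \<le> t" "s \<noteq> t"
  shows "L2_norm M (\<lambda>x. (S s f x - S t f x) / (s - t) - S t (A f) x)
    \<le> L2_norm M (\<lambda>x. (S \<bar>s - t\<bar> f x - f x) / \<bar>s - t\<bar> - A f x) + L2_norm M (\<lambda>x. S s (A f) x - S t (A f) x)"
proof -
  define m h where "m = min s t" and "h = \<bar>s - t\<bar>"
  have m: "0 \<le> m" and h: "0 < h" using st by (auto simp: m_def h_def)
  have fL2: "f \<in> L2 M" "A f \<in> L2 M" using f by (auto intro: D_L2 A_L2)
  define q where "q = (\<lambda>x. (S h f x - f x) / h)"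
  have q: "q \<in> L2 M" unfolding q_def using fL2 h by (intro L2_divide L2_diff S_L2) auto
  have "L2_eq M (S m q) (\<lambda>x. S m (\<lambda>x. S h f x - f x) x / h)"
    unfolding q_def using fL2 h m by (intro S_divide) (auto intro!: L2_diff S_L2)
  also have "L2_eq M \<dots> (\<lambda>x. (S m (S h f) x - S m f x) / h)"
    using fL2 h m by (intro L2_eq_divide S_diff) (auto intro: S_L2)
  also have "L2_eq M \<dots> (\<lambda>x. (S (m + h) f x - S m f x) / h)"
    using fL2 h m by (intro L2_eq_divide L2_eq_diff L2_eq_sym[OF S_semigroup] L2_eq_refl) (auto intro: S_L2)
  also have "(\<lambda>x. (S (m + h) f x - S m f x) / h) = (\<lambda>x. (S s f x - S t f x) / (s - t))"
  proof (cases "s < t")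
    case True
    then show ?thesis
      using minus_divide_divide[of "S s f x - S t f x" "s - t" for x] by (simp add: m_def h_def)
  qed (use st in \<open>simp add: m_def h_def\<close>)
  finally have eq: "L2_eq M (S m q) (\<lambda>x. (S s f x - S t f x) / (s - t))" .
  have "L2_norm M (\<lambda>x. (S s f x - S t f x) / (s - t) - S t (A f) x) = L2_norm M (\<lambda>x. S m q x - S t (A f) x)"
    using fL2 st by (intro L2_norm_cong L2_eq_diff L2_eq_sym[OF eq] L2_eq_refl S_L2)
  also have "\<dots> \<le> L2_norm M (\<lambda>x. S m q x - S m (A f) x) + L2_norm M (\<lambda>x. S m (A f) x - S t (A f) x)"
    using fL2 q m st by (intro L2_norm_diff_triangle S_L2)
  also have "L2_norm M (\<lambda>x. S m q x - S m (A f) x) \<le> L2_norm M (\<lambda>x. q x - A f x)"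
    using fL2 q m by (intro S_diff_le)
  also have "L2_norm M (\<lambda>x. S m (A f) x - S t (A f) x) \<le> L2_norm M (\<lambda>x. S s (A f) x - S t (A f) x)"
    by (simp add: m_def min_def)
  finally show ?thesis by (simp add: q_def h_def)
qed

lemma S_has_derivative:
  assumes f: "f \<in> D" and t: "0 \<le> t"
  shows "L2_tendsto M (\<lambda>s x. (S s f x - S t f x) / (s - t)) (S t (A f)) (at t within {0..})"
  unfolding L2_tendsto_def
proof (rule Lim_null_comparison)
  have ev: "\<forall>\<^sub>F s in at t within {0..}. 0 \<le> s \<and> s \<noteq> t"
    by (simp add: eventually_at_filter)
  have "filterlim (\<lambda>s. \<bar>s - t\<bar>) (at_right 0) (at t within {0..})"
    unfolding filterlim_at
  proof
    show "\<forall>\<^sub>F s in at t within {0..}. \<bar>s - t\<bar> \<in> {0<..} \<and> \<bar>s - t\<bar> \<noteq> 0"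
      using ev by eventually_elim auto
    have "((\<lambda>s. \<bar>s - t\<bar>) \<longlongrightarrow> \<bar>t - t\<bar>) (at t within {0..})" by (intro tendsto_intros)
    then show "((\<lambda>s. \<bar>s - t\<bar>) \<longlongrightarrow> 0) (at t within {0..})" by simp
  qed
  from filterlim_compose[OF A_tendsto[OF f, unfolded L2_tendsto_def] this]
  have "((\<lambda>s. L2_norm M (\<lambda>x. (S \<bar>s - t\<bar> f x - f x) / \<bar>s - t\<bar> - A f x)) \<longlongrightarrow> 0) (at t within {0..})" .
  moreover have "((\<lambda>s. L2_norm M (\<lambda>x. S s (A f) x - S t (A f) x)) \<longlongrightarrow> 0) (at t within {0..})"
    using S_continuous[OF t A_L2[OF f]] by (simp add: L2_tendsto_def)
  ultimately show "((\<lambda>s. L2_norm M (\<lambda>x. (S \<bar>s - t\<bar> f x - f x) / \<bar>s - t\<bar> - A f x)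
      + L2_norm M (\<lambda>x. S s (A f) x - S t (A f) x)) \<longlongrightarrow> 0) (at t within {0..})"
    by (rule tendsto_add_zero)
  show "\<forall>\<^sub>F s in at t within {0..}. norm (L2_norm M (\<lambda>x. (S s f x - S t f x) / (s - t) - S t (A f) x))
      \<le> L2_norm M (\<lambda>x. (S \<bar>s - t\<bar> f x - f x) / \<bar>s - t\<bar> - A f x) + L2_norm M (\<lambda>x. S s (A f) x - S t (A f) x)"
    using ev by eventually_elim (use S_quotient_bound[OF f _ t] in simp)
qed

text \<open>\<open>S h\<close> and \<open>S t\<close> commute through \<open>S (t + h)\<close>, so
  the quotient of \<open>S t f\<close> is the image under \<open>S t\<close> of the quotient of
  \<open>f\<close>, and contraction preserves its convergence.\<close>

lemma S_generates:
  assumes f: "f \<in> D" and t: "0 \<le> t"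
  shows "generates M S (S t f) (S t (A f))"
  unfolding generates_def
proof
  have fL2: "f \<in> L2 M" "A f \<in> L2 M" using f by (auto intro: D_L2 A_L2)
  show "S t (A f) \<in> L2 M" using fL2 t by (intro S_L2)
  show "L2_tendsto M (\<lambda>h x. (S h (S t f) x - S t f x) / h) (S t (A f)) (at_right 0)"
    unfolding L2_tendsto_def
  proof (rule Lim_null_comparison)
    show "((\<lambda>h. L2_norm M (\<lambda>x. (S h f x - f x) / h - A f x)) \<longlongrightarrow> 0) (at_right 0)"
      using A_tendsto[OF f] unfolding L2_tendsto_def .
    show "\<forall>\<^sub>F h in at_right 0. norm (L2_norm M (\<lambda>x. (S h (S t f) x - S t f x) / h - S t (A f) x))
      \<le> L2_norm M (\<lambda>x. (S h f x - f x) / h - A f x)"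
      using eventually_at_right_less[of "0::real"]
    proof eventually_elim
      case (elim h)
      have q: "(\<lambda>x. (S h f x - f x) / h) \<in> L2 M" using fL2 elim by (intro L2_divide L2_diff S_L2) auto
      have "L2_eq M (S t (\<lambda>x. (S h f x - f x) / h)) (\<lambda>x. S t (\<lambda>x. S h f x - f x) x / h)"
        using fL2 elim t by (intro S_divide) (auto intro!: L2_diff S_L2)
      also have "L2_eq M \<dots> (\<lambda>x. (S t (S h f) x - S t f x) / h)"
        using fL2 elim t by (intro L2_eq_divide S_diff) (auto intro: S_L2)
      also have "L2_eq M \<dots> (\<lambda>x. (S (t + h) f x - S t f x) / h)"
        using fL2 elim t by (intro L2_eq_divide L2_eq_diff L2_eq_sym[OF S_semigroup] L2_eq_refl) (auto intro: S_L2)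
      also have "L2_eq M \<dots> (\<lambda>x. (S h (S t f) x - S t f x) / h)"
        using fL2 elim t S_semigroup[of h t f]
        by (intro L2_eq_divide L2_eq_diff L2_eq_refl S_L2) (auto simp: add.commute)
      finally have eq: "L2_eq M (S t (\<lambda>x. (S h f x - f x) / h)) (\<lambda>x. (S h (S t f) x - S t f x) / h)" .
      have "L2_norm M (\<lambda>x. (S h (S t f) x - S t f x) / h - S t (A f) x)
          = L2_norm M (\<lambda>x. S t (\<lambda>x. (S h f x - f x) / h) x - S t (A f) x)"
        using fL2 t by (intro L2_norm_cong L2_eq_diff L2_eq_sym[OF eq] L2_eq_refl S_L2)
      also have "\<dots> \<le> L2_norm M (\<lambda>x. (S h f x - f x) / h - A f x)"
        using fL2 q t by (intro S_diff_le)
      finally show ?case by simp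
    qed
  qed
qed

lemma S_D: "f \<in> D \<Longrightarrow> 0 \<le> t \<Longrightarrow> S t f \<in> D"
  by (rule D_A_I(1)[OF S_L2[OF _ D_L2] S_generates])

lemma A_S: "f \<in> D \<Longrightarrow> 0 \<le> t \<Longrightarrow> L2_eq M (A (S t f)) (S t (A f))"
  by (rule D_A_I(2)[OF S_L2[OF _ D_L2] S_generates])

lemma S_inner_has_derivative:
  assumes fg: "f \<in> D" "g \<in> D" and t: "0 \<le> t"
  shows "((\<lambda>s. L2_inner M (S s f) (S s g)) has_real_derivative
    L2_inner M (S t (A f)) (S t g) + L2_inner M (S t f) (S t (A g))) (at t within {0..})"
  unfolding has_field_derivative_iff
proof (rule Lim_transform_eventually)
  have L2: "f \<in> L2 M" "g \<in> L2 M" "A f \<in> L2 M" "A g \<in> L2 M" using fg by (auto intro: D_L2 A_L2)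
  have ev: "\<forall>\<^sub>F s in at t within {0..}. 0 \<le> s \<and> s \<noteq> t"
    by (simp add: eventually_at_filter)
  have q: "\<forall>\<^sub>F s in at t within {0..}. (\<lambda>x. (S s h x - S t h x) / (s - t)) \<in> L2 M"
    if "h \<in> L2 M" for h
    using ev by eventually_elim (intro L2_divide L2_diff S_L2 that t; simp)
  have Sev: "\<forall>\<^sub>F s in at t within {0..}. S s h \<in> L2 M" if "h \<in> L2 M" for h
    using ev by eventually_elim (use that t in \<open>auto intro: S_L2\<close>)
  \<comment> \<open>Discrete product rule: the increment of \<open>f\<close> is paired with the
    moving \<open>S s g\<close>, that of \<open>g\<close> with the fixed
    \<open>S t f\<close>.\<close>
  show "((\<lambda>s. L2_inner M (\<lambda>x. (S s f x - S t f x) / (s - t)) (S s g)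
      + L2_inner M (S t f) (\<lambda>x. (S s g x - S t g x) / (s - t)))
    \<longlongrightarrow> L2_inner M (S t (A f)) (S t g) + L2_inner M (S t f) (S t (A g))) (at t within {0..})"
    using L2 t by (intro tendsto_add L2_tendsto_inner_both S_has_derivative fg S_continuous S_L2 q Sev
        L2_tendsto_const always_eventually allI)
  show "\<forall>\<^sub>F s in at t within {0..}. L2_inner M (\<lambda>x. (S s f x - S t f x) / (s - t)) (S s g)
      + L2_inner M (S t f) (\<lambda>x. (S s g x - S t g x) / (s - t))
    = (L2_inner M (S s f) (S s g) - L2_inner M (S t f) (S t g)) / (s - t)"
    using ev
  proof eventually_elim
    case (elim s)
    have "S s f \<in> L2 M" "S t f \<in> L2 M" "S s g \<in> L2 M" "S t g \<in> L2 M"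
      using elim t L2 by (auto intro: S_L2)
    then show ?case
      by (simp add: L2_inner_simps add_divide_distrib[symmetric])
  qed
qed

text \<open>Time averages of orbits lie in the domain: the quotient of \<open>u h\<close> tends to
  \<open>T h \<phi> - T 0 \<phi>\<close> by the fundamental theorem of calculus at both endpoints.
  Integral and limit are taken in the supremum norm, which dominates the L2 norm.\<close>

lemma T_average:
  fixes \<phi> :: "'a \<Rightarrow>\<^sub>C real"
  assumes h: "0 < h"
  defines "u \<equiv> \<lambda>r. integral {0..r} (\<lambda>s. T s \<phi>)"
  shows "apply_bcontfun (u h) \<in> D"
proof -
  have cont: "continuous_on {a..b} (\<lambda>s. T s \<phi>)" if "0 \<le> a" for a b
    using continuous_on_subset[OF T_continuous] that by auto
  have quot: "((\<lambda>t. (1 / t) *\<^sub>R (u (r + t) - u r)) \<longlongrightarrow> T r \<phi>) (at_right 0)" if r: "0 \<le> r" for r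
  proof -
    have "(u has_vector_derivative T r \<phi>) (at r within {0..r+1})"
      unfolding u_def using r by (intro integral_has_vector_derivative cont) auto
    then have "(u has_vector_derivative T r \<phi>) (at r within {r..r+1})"
      by (rule has_vector_derivative_within_subset) (use r in auto)
    then have "(u has_vector_derivative T r \<phi>) (at_right r)"
      using at_within_Icc_at_right[of r "r + 1"] by simp
    then show ?thesis by (rule has_vector_derivative_at_right_quotient)
  qed
  \<comment> \<open>\<open>T t\<close> shifts the window of integration from \<open>[0, h]\<close>
    to \<open>[t, h + t]\<close>.\<close>
  have T_u: "T t (u h) = u (h + t) - u t" if t: "0 \<le> t" for t
  proof -
    have "T t (u h) = integral {0..h} (T t \<circ> (\<lambda>s. T s \<phi>))"
      unfolding u_def using t by (intro integral_linear[symmetric] T_linear integrable_continuous_interval cont) auto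
    also have "\<dots> = integral {0..h} (\<lambda>s. T (s + t) \<phi>)"
      using t by (intro integral_cong) (auto simp: T_add[symmetric] add.commute)
    also have "\<dots> = integral {0 + t..h + t} (\<lambda>s. T s \<phi>)"
      using integral_shift_Icc_real[of 0 h _ t] by (simp add: o_def add.commute)
    also have "\<dots> = u (h + t) - u t"
      unfolding u_def using Henstock_Kurzweil_Integration.integral_combine[where a = 0 and c = t and b = "h + t" and f = "\<lambda>s. T s \<phi>"] t h
      by (simp add: integrable_continuous_interval[OF cont] algebra_simps)
    finally show ?thesis .
  qed
  have u0: "u 0 = 0" by (simp add: u_def)
  have "((\<lambda>t. (1 / t) *\<^sub>R (u (h + t) - u h) - (1 / t) *\<^sub>R (u (0 + t) - u 0)) \<longlongrightarrow> T h \<phi> - T 0 \<phi>) (at_right 0)"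
    using h by (intro tendsto_diff quot) auto
  moreover have "\<forall>\<^sub>F t in at_right 0. (1 / t) *\<^sub>R (u (h + t) - u h) - (1 / t) *\<^sub>R (u (0 + t) - u 0)
      = (1 / t) *\<^sub>R (T t (u h) - u h)"
    using eventually_at_right_less[of "0::real"]
    by eventually_elim (simp add: T_u u0 scaleR_diff_right)
  ultimately have "((\<lambda>t. (1 / t) *\<^sub>R (T t (u h) - u h)) \<longlongrightarrow> T h \<phi> - T 0 \<phi>) (at_right 0)"
    by (rule Lim_transform_eventually)
  from bcontfun_L2_tendsto[OF this]
  have "L2_tendsto M (\<lambda>t x. (T t (u h) x - u h x) / t) (apply_bcontfun (T h \<phi> - T 0 \<phi>)) (at_right 0)"
    by (simp add: divide_inverse mult.commute)
  then have "L2_tendsto M (\<lambda>t x. (S t (apply_bcontfun (u h)) x - u h x) / t) (apply_bcontfun (T h \<phi> - T 0 \<phi>)) (at_right 0)"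
  proof (rule L2_tendsto_cong[OF L2_eq_refl[OF bcontfun_L2], rotated])
    show "\<forall>\<^sub>F t in at_right 0. L2_eq M (\<lambda>x. (T t (u h) x - u h x) / t) (\<lambda>x. (S t (apply_bcontfun (u h)) x - u h x) / t)"
      using eventually_at_right_less[of "0::real"]
      by eventually_elim (intro L2_eq_divide L2_eq_diff L2_eq_sym[OF S_bcontfun] L2_eq_refl bcontfun_L2; simp)
  qed
  then show ?thesis
    by (intro D_A_I(1)[OF bcontfun_L2]) (auto simp: generates_def)
qed

text \<open>The averages \<open>(1 / h) *\<^sub>R u h\<close> tend to \<open>\<phi>\<close> as
  \<open>h\<close> tends to 0, so \<open>w\<close> is orthogonal to every continuous function and,
  by density, to itself.\<close>

lemma D_dense:
  assumes w: "w \<in> L2 M" and orth: "\<And>f. f \<in> D \<Longrightarrow> L2_inner M f w = 0"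
  shows "L2_norm M w = 0"
proof -
  have orth_bcontfun: "L2_inner M \<phi> w = 0" for \<phi> :: "'a \<Rightarrow>\<^sub>C real"
  proof -
    define u where "u r = integral {0..r} (\<lambda>s. T s \<phi>)" for r
    have "(u has_vector_derivative T 0 \<phi>) (at 0 within {0..1})"
      unfolding u_def
      by (intro integral_has_vector_derivative continuous_on_subset[OF T_continuous]) auto
    then have "(u has_vector_derivative \<phi>) (at_right 0)"
      using at_within_Icc_at_right[of 0 "1::real"] by (simp add: T_zero)
    then have lim: "((\<lambda>h. (1 / h) *\<^sub>R u h) \<longlongrightarrow> \<phi>) (at_right 0)"
      using has_vector_derivative_at_right_quotient[of u \<phi> 0] by (simp add: u_def)
    have "((\<lambda>h. L2_inner M (apply_bcontfun ((1 / h) *\<^sub>R u h)) w) \<longlongrightarrow> L2_inner M \<phi> w) (at_right 0)"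
      using w by (intro L2_tendsto_inner bcontfun_L2_tendsto[OF lim]) auto
    moreover have "\<forall>\<^sub>F h in at_right 0. L2_inner M (apply_bcontfun ((1 / h) *\<^sub>R u h)) w = 0"
      using eventually_at_right_less[of "0::real"]
      by eventually_elim (use orth[OF T_average] in \<open>simp add: u_def L2_inner_simps\<close>)
    ultimately have "((\<lambda>h::real. 0) \<longlongrightarrow> L2_inner M \<phi> w) (at_right 0)"
      by (rule Lim_transform_eventually)
    then show ?thesis
      using tendsto_unique[OF trivial_limit_at_right_real _ tendsto_const] by metis
  qed
  obtain \<phi> :: "nat \<Rightarrow> ('a \<Rightarrow>\<^sub>C real)" where \<phi>: "L2_tendsto M (\<lambda>k. apply_bcontfun (\<phi> k)) w sequentially"
    using bcontfun_dense_sequence[OF w] by blast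
  have "(\<lambda>k. L2_inner M (\<phi> k) w) \<longlonglongrightarrow> L2_inner M w w"
    using w \<phi> by (intro L2_tendsto_inner) auto
  then have "L2_inner M w w = 0" by (simp add: orth_bcontfun LIMSEQ_const_iff)
  then show ?thesis by (simp add: L2_norm_def)
qed

end

section \<open>Log-convexity in time\<close>

text \<open>The calculus part, for three consecutive energies. Mind the sign: \<open>e'\<close> is
  minus the derivative of \<open>e\<close>, so \<open>e''\<close> is its second derivative.
  Derivatives within \<open>{0..}\<close> are one-sided at 0.\<close>

locale log_convex_decay =
  fixes e e' e'' :: "real \<Rightarrow> real"
  assumes e_deriv: "0 \<le> t \<Longrightarrow> (e has_real_derivative - e' t) (at t within {0..})"
    and e'_deriv: "0 \<le> t \<Longrightarrow> (e' has_real_derivative - e'' t) (at t within {0..})"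
    and e'_nonneg: "0 \<le> t \<Longrightarrow> 0 \<le> e' t"
    and e'_square: "0 \<le> t \<Longrightarrow> (e' t)\<^sup>2 \<le> e t * e'' t"
    and e_pos: "0 < t \<Longrightarrow> 0 < e t"
begin

lemma mvt_half_line:
  assumes "\<And>t. 0 \<le> t \<Longrightarrow> (f has_real_derivative f' t) (at t within {0..})" "0 \<le> a" "a < b"
  obtains z where "a < z" "z < b" "f b - f a = f' z * (b - a)"
proof -
  have "(f has_derivative (\<lambda>h. f' x * h)) (at x within {a..b})" if "x \<in> {a..b}" for x
    using assms(2,3) that
    by (intro has_derivative_subset[OF assms(1)[of x, unfolded has_field_derivative_def]]) auto
  with mvt_simple[OF assms(3), of f "\<lambda>x h. f' x * h"] that show thesis by auto
qed

lemma e_antimono: "0 \<le> s \<Longrightarrow> s \<le> t \<Longrightarrow> e t \<le> e s"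
proof -
  assume st: "0 \<le> s" "s \<le> t"
  show "e t \<le> e s"
  proof (cases "s = t")
    case False
    then obtain z where "s < z" "e t - e s = - e' z * (t - s)"
      using mvt_half_line[of e "\<lambda>t. - e' t" s t] e_deriv st by auto
    moreover have "0 \<le> e' z * (t - s)" using e'_nonneg[of z] \<open>s < z\<close> st by simp
    ultimately show ?thesis by simp
  qed simp
qed

text \<open>At time 0 positivity comes from \<open>e 0 \<ge> e 1 > 0\<close>; it makes
  \<open>ln (e 0)\<close> and division by \<open>e 0\<close> meaningful.\<close>

lemma e_pos_closed: "0 \<le> t \<Longrightarrow> 0 < e t"
  using e_pos[of t] e_pos[of 1] e_antimono[of 0 1] by (cases "t = 0") auto

definition L' :: "real \<Rightarrow> real" where "L' t = - e' t / e t"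
definition L'' :: "real \<Rightarrow> real" where "L'' t = (e t * e'' t - (e' t)\<^sup>2) / (e t)\<^sup>2"

lemma ln_e_deriv: "0 \<le> t \<Longrightarrow> ((\<lambda>s. ln (e s)) has_real_derivative L' t) (at t within {0..})"
  using e_pos_closed[of t] e_deriv[of t]
  by (auto intro!: derivative_eq_intros simp: L'_def)

lemma L'_deriv:
  assumes "0 \<le> t"
  shows "(L' has_real_derivative L'' t) (at t within {0..})"
proof -
  have "((\<lambda>s. - e' s / e s) has_real_derivative L'' t) (at t within {0..})"
    using e_pos_closed[OF assms]
    by (auto intro!: derivative_eq_intros e_deriv e'_deriv assms simp: L''_def field_simps power2_eq_square)
  then show ?thesis unfolding L'_def[abs_def] .
qed

lemma L''_nonneg: "0 \<le> t \<Longrightarrow> 0 \<le> L'' t"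
  using e'_square[of t] by (simp add: L''_def)

lemma L'_mono: "0 \<le> s \<Longrightarrow> s \<le> t \<Longrightarrow> L' s \<le> L' t"
proof -
  assume st: "0 \<le> s" "s \<le> t"
  show "L' s \<le> L' t"
  proof (cases "s = t")
    case False
    then obtain z where "s < z" "L' t - L' s = L'' z * (t - s)"
      using mvt_half_line[of L' L'' s t] L'_deriv st by auto
    moreover have "0 \<le> L'' z * (t - s)" using L''_nonneg[of z] \<open>s < z\<close> st by simp
    ultimately show ?thesis by simp
  qed simp
qed

text \<open>The chord slopes on the two sides of \<open>z\<close> are values of the increasing
  function \<open>L'\<close> at points \<open>v < z < w\<close>.\<close>

lemma ln_e_convex: "convex_on {0..} (\<lambda>t. ln (e t))"
proof (rule convex_on_linorderI)
  fix t x y :: real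
  assume t: "0 < t" "t < 1" and xy: "x \<in> {0..}" "y \<in> {0..}" "x < y"
  define z where "z = (1 - t) * x + t * y"
  have zx: "z - x = t * (y - x)" and yz: "y - z = (1 - t) * (y - x)"
    by (simp_all add: z_def algebra_simps)
  have "x < z" "z < y" using t xy zx yz by (smt (verit) mult_pos_pos)+
  obtain v where v: "x < v" "v < z" "ln (e z) - ln (e x) = L' v * (z - x)"
    using mvt_half_line[of "\<lambda>t. ln (e t)" L' x z] ln_e_deriv xy \<open>x < z\<close> by auto
  obtain w where w: "z < w" "w < y" "ln (e y) - ln (e z) = L' w * (y - z)"
    using mvt_half_line[of "\<lambda>t. ln (e t)" L' z y] ln_e_deriv xy \<open>x < z\<close> \<open>z < y\<close> by auto
  \<comment> \<open>The weights \<open>1 - t\<close> and \<open>t\<close> give both slopes the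
    common factor \<open>t * (1 - t) * (y - x)\<close>.\<close>
  have "(1 - t) * (ln (e z) - ln (e x)) = L' v * (t * (1 - t) * (y - x))"
    unfolding v zx by (simp add: algebra_simps)
  also have "\<dots> \<le> L' w * (t * (1 - t) * (y - x))"
    using v w t xy by (intro mult_right_mono L'_mono mult_nonneg_nonneg) auto
  also have "\<dots> = t * (ln (e y) - ln (e z))"
    unfolding w yz by (simp add: algebra_simps)
  finally show "ln (e ((1 - t) *\<^sub>R x + t *\<^sub>R y)) \<le> (1 - t) * ln (e x) + t * ln (e y)"
    by (simp add: z_def algebra_simps)
qed simp

abbreviation rate :: "real \<Rightarrow> real" where
  "rate t \<equiv> (e t / e 0) powr (1 / t)"

lemma rate_mono: "0 < s \<Longrightarrow> s \<le> t \<Longrightarrow> rate s \<le> rate t"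
proof -
  assume st: "0 < s" "s \<le> t"
  have exp: "rate r = exp ((ln (e r) - ln (e 0)) / r)" if "0 < r" for r
    using that e_pos_closed[of r] e_pos_closed[of 0] by (simp add: powr_def ln_div)
  \<comment> \<open>\<open>s\<close> is the convex combination of \<open>0\<close> and
    \<open>t\<close> with weight \<open>s / t\<close> on \<open>t\<close>.\<close>
  have "ln (e ((1 - s / t) *\<^sub>R 0 + (s / t) *\<^sub>R t)) \<le> (1 - s / t) * ln (e 0) + (s / t) * ln (e t)"
    using st by (intro convex_onD[OF ln_e_convex]) auto
  then have "ln (e s) - ln (e 0) \<le> s * ((ln (e t) - ln (e 0)) / t)"
    using st by (simp add: algebra_simps diff_divide_distrib)
  then have "(ln (e s) - ln (e 0)) / s \<le> (ln (e t) - ln (e 0)) / t"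
    using st by (simp add: pos_divide_le_eq mult.commute)
  then show ?thesis using st by (simp add: exp)
qed

lemma rate_le_one: "0 < t \<Longrightarrow> rate t \<le> 1"
  using e_antimono[of 0 t] e_pos_closed[of t] e_pos_closed[of 0] by (intro powr_le1) auto

text \<open>The limit is the supremum over positive times, where the rate is increasing and bounded
  by 1.\<close>

lemma rate_convergent: "\<exists>l. (rate \<longlongrightarrow> l) at_top"
proof
  have bdd: "bdd_above (rate ` {0<..})" using rate_le_one by (auto intro!: bdd_aboveI[of _ 1])
  show "(rate \<longlongrightarrow> (SUP t\<in>{0<..}. rate t)) at_top"
  proof (rule order_tendstoI)
    fix a assume "a < (SUP t\<in>{0<..}. rate t)"
    then obtain s where s: "0 < s" "a < rate s"
      using bdd by (subst (asm) less_cSUP_iff) auto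
    show "\<forall>\<^sub>F t in at_top. a < rate t"
      using eventually_ge_at_top[of s]
      by eventually_elim (use s rate_mono in \<open>auto intro: less_le_trans\<close>)
  next
    fix a assume a: "(SUP t\<in>{0<..}. rate t) < a"
    show "\<forall>\<^sub>F t in at_top. rate t < a"
      using eventually_gt_at_top[of 0]
    proof eventually_elim
      case (elim t)
      then have "rate t \<le> (SUP t\<in>{0<..}. rate t)" using bdd by (intro cSUP_upper) auto
      with a show ?case by simp
    qed
  qed
qed

end

section \<open>The energies along the semigroup\<close>

locale normal_markov_L2 = markov_L2 +
  assumes normal: "normal_operator M (gen_dom M (L2_semigroup M T)) (gen M (L2_semigroup M T))"
begin

sublocale gen: normal_markov_generator M D A
proof
  show "(\<lambda>x. f x + g x) \<in> D" "L2_eq M (A (\<lambda>x. f x + g x)) (\<lambda>x. A f x + A g x)"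
    if "f \<in> D" "g \<in> D" for f g
    using D_A_I[OF L2_add[OF D_L2 D_L2] generates_add] that by blast+
  show "(\<lambda>x. c * f x) \<in> D" "L2_eq M (A (\<lambda>x. c * f x)) (\<lambda>x. c * A f x)" if "f \<in> D" for f c
    using D_A_I[OF L2_scale[OF D_L2] generates_scale] that by blast+
qed (use D_L2 A_L2 D_dense normal one_D A_one A_mean dissipative in auto)

lemma S_pow_dom: "0 \<le> t \<Longrightarrow> f \<in> pow_dom M D A n \<Longrightarrow> S t f \<in> pow_dom M D A n"
proof (induction n arbitrary: f)
  case 0
  then show ?case by (simp add: S_L2)
next
  case (Suc n)
  then show ?case
    using S_D[of f t] gen.pow_dom_cong[OF Suc.IH L2_eq_sym[OF A_S]] by simp
qed

lemma S_V: "0 \<le> t \<Longrightarrow> f \<in> gen.V \<Longrightarrow> S t f \<in> gen.V"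
  unfolding inf_dom_def using S_pow_dom by blast

text \<open>Two different arguments are needed because \<open>energy M A (Suc m)\<close> pairs
  \<open>A f\<close> with \<open>g\<close>, to which the induction hypothesis must apply. Up to sign
  the derivative unfolds to the next energy.\<close>

lemma energy_has_derivative:
  assumes "f \<in> gen.V" "g \<in> gen.V" and t: "0 \<le> t"
  shows "((\<lambda>s. energy M A m (S s f) (S s g)) has_real_derivative
    energy M A m (A (S t f)) (S t g) + energy M A m (S t f) (A (S t g))) (at t within {0..})"
  using assms(1,2)
proof (induction m arbitrary: f g)
  case 0
  then have D: "f \<in> D" "g \<in> D" by (auto intro: gen.V_D)
  then have L2: "f \<in> L2 M" "g \<in> L2 M" by (auto intro: D_L2)
  \<comment> \<open>Stationarity freezes both means at their initial values, so in
    \<open>energy M A 0\<close> only the inner product varies.\<close>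
  have "((\<lambda>s. L2_inner M (S s f) (S s g) - L2_inner M f (\<lambda>_. 1) * L2_inner M g (\<lambda>_. 1)) has_real_derivative
      L2_inner M (S t (A f)) (S t g) + L2_inner M (S t f) (S t (A g))) (at t within {0..})"
    using DERIV_diff[OF S_inner_has_derivative[OF D t] DERIV_const] by simp
  then have "((\<lambda>s. energy M A 0 (S s f) (S s g)) has_real_derivative
      L2_inner M (S t (A f)) (S t g) + L2_inner M (S t f) (S t (A g))) (at t within {0..})"
    by (rule has_field_derivative_transform_within[where d = 1])
      (use t L2 in \<open>auto simp: S_mean\<close>)
  moreover have "L2_inner M (S t (A f)) (S t g) = L2_inner M (A (S t f)) (S t g)"
    "L2_inner M (S t f) (S t (A g)) = L2_inner M (S t f) (A (S t g))"
    using D L2 t by (auto intro!: L2_inner_cong L2_eq_sym[OF A_S] L2_eq_refl S_L2)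
  ultimately show ?case
    using D t by (simp add: A_mean S_D)
next
  case (Suc m)
  have V: "A f \<in> gen.V" "A g \<in> gen.V" using Suc.prems by (auto intro: gen.V_A)
  have A_S_V: "L2_eq M (A (S s h)) (S s (A h))" if "0 \<le> s" "h \<in> gen.V" for s h
    using that by (intro A_S gen.V_D)
  \<comment> \<open>\<open>A (S s h)\<close> and \<open>S s (A h)\<close> may be different
    representatives; the energies do not distinguish them.\<close>
  have left: "energy M A n (A (S s h)) k = energy M A n (S s (A h)) k"
    if "0 \<le> s" "h \<in> gen.V" "k \<in> gen.V" for n s h k
    using that by (intro gen.E_cong A_S_V L2_eq_refl D_L2 gen.V_D gen.V_A S_V)
  have right: "energy M A n k (A (S s h)) = energy M A n k (S s (A h))"
    if "0 \<le> s" "h \<in> gen.V" "k \<in> gen.V" for n s h k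
    using left[OF that] by (simp only: gen.E_commute[of n k])
  have "((\<lambda>s. - energy M A m (S s (A f)) (S s g) - energy M A m (S s f) (S s (A g))) has_real_derivative
      - (energy M A m (A (S t (A f))) (S t g) + energy M A m (S t (A f)) (A (S t g)))
      - (energy M A m (A (S t f)) (S t (A g)) + energy M A m (S t f) (A (S t (A g))))) (at t within {0..})"
    using Suc.prems V by (intro DERIV_diff DERIV_minus Suc.IH)
  then have deriv: "((\<lambda>s. energy M A (Suc m) (S s f) (S s g)) has_real_derivative
      - (energy M A m (A (S t (A f))) (S t g) + energy M A m (S t (A f)) (A (S t g)))
      - (energy M A m (A (S t f)) (S t (A g)) + energy M A m (S t f) (A (S t (A g))))) (at t within {0..})"
    by (rule has_field_derivative_transform_within[where d = 1])
      (use t Suc.prems left right S_V in auto)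
  have "energy M A (Suc m) (A (S t f)) (S t g) = energy M A (Suc m) (S t (A f)) (S t g)"
    "energy M A (Suc m) (S t f) (A (S t g)) = energy M A (Suc m) (S t f) (S t (A g))"
    using left[OF t Suc.prems(1) S_V[OF t Suc.prems(2)]] right[OF t Suc.prems(2) S_V[OF t Suc.prems(1)]]
    by (simp_all only:)
  then show ?case by (intro DERIV_cong[OF deriv]) simp
qed

lemma energy_decay:
  assumes "f \<in> gen.V" "0 \<le> t"
  shows "((\<lambda>s. energy M A m (S s f) (S s f)) has_real_derivative
    - energy M A (Suc m) (S t f) (S t f)) (at t within {0..})"
  using energy_has_derivative[OF assms(1) assms(1) assms(2), of m] by (simp add: add.commute)

end

theorem theorem3p7:
  fixes T :: "real \<Rightarrow> ('a::topological_space \<Rightarrow>\<^sub>C real) \<Rightarrow> ('a \<Rightarrow>\<^sub>C real)"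
    and \<mu> :: "'a measure"
    and D :: "('a \<Rightarrow> real) set"
    and A :: "('a \<Rightarrow> real) \<Rightarrow> ('a \<Rightarrow> real)"
    and g\<^sub>0 :: "'a \<Rightarrow> real"
    and g :: "real \<Rightarrow> 'a \<Rightarrow> real"
    and e :: "nat \<Rightarrow> real \<Rightarrow> real"
    and n :: nat
  assumes compact: "compact (UNIV :: 'a set)"
    and metrizable: "metrizable_space (euclidean :: 'a topology)"
    and semigroup: "markov_semigroup T"
    and stationary: "stationary_prob T \<mu>"
    and D_eq: "D = gen_dom \<mu> (L2_semigroup \<mu> T)"
    and A_eq: "A = gen \<mu> (L2_semigroup \<mu> T)"
    and normal: "normal_operator \<mu> D A"
    and g0: "g\<^sub>0 \<in> inf_dom \<mu> D A"
    and g_eq: "g = (\<lambda>t. L2_semigroup \<mu> T t g\<^sub>0)"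
    and e_eq: "e = (\<lambda>m t. energy \<mu> A m (g t) (g t))"
    and pos: "\<forall>t>0. 0 < e n t"
  shows "0 < e n 0 \<and>
    (convex_on {0..} (\<lambda>t. ln (e n t)) \<and>
     (\<exists>L' L''. \<forall>t\<ge>0.
        ((\<lambda>s. ln (e n s)) has_real_derivative L' t) (at t within {0..}) \<and>
        (L' has_real_derivative L'' t) (at t within {0..}) \<and>
        0 \<le> L'' t)) \<and>
    (mono_on {0<..} (\<lambda>t. (e n t / e n 0) powr (1 / t)) \<and>
     (\<exists>l. ((\<lambda>t. (e n t / e n 0) powr (1 / t)) \<longlongrightarrow> l) at_top))"
proof -
  interpret prob_space \<mu> using stationary by (simp add: stationary_prob_def)
  interpret normal_markov_L2 \<mu> T
    using metrizable semigroup stationary normal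
    by unfold_locales (auto simp: stationary_prob_def D_eq A_eq)
  have V: "g t \<in> gen.V" if "0 \<le> t" for t
    using S_V[OF that] g0 by (simp add: g_eq D_eq A_eq)
  interpret log_convex_decay "e n" "e (Suc n)" "e (Suc (Suc n))"
  proof
    fix t :: real assume t: "0 \<le> t"
    show "(e n has_real_derivative - e (Suc n) t) (at t within {0..})"
      "(e (Suc n) has_real_derivative - e (Suc (Suc n)) t) (at t within {0..})"
      using energy_decay[OF _ t] g0 by (simp_all add: e_eq g_eq D_eq A_eq del: energy.simps)
    show "0 \<le> e (Suc n) t"
      using gen.E_nonneg[OF V[OF t]] by (simp add: e_eq A_eq del: energy.simps)
    show "(e (Suc n) t)\<^sup>2 \<le> e n t * e (Suc (Suc n)) t"
      using gen.E_log_convex[OF V[OF t]] by (simp add: e_eq A_eq del: energy.simps)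
  qed (use pos in simp)
  show ?thesis
  proof (intro conjI)
    show "0 < e n 0" by (simp add: e_pos_closed)
    show "\<exists>L' L''. \<forall>t\<ge>0.
        ((\<lambda>s. ln (e n s)) has_real_derivative L' t) (at t within {0..}) \<and>
        (L' has_real_derivative L'' t) (at t within {0..}) \<and> 0 \<le> L'' t"
      using ln_e_deriv L'_deriv L''_nonneg by blast
    show "mono_on {0<..} (\<lambda>t. (e n t / e n 0) powr (1 / t))"
      by (intro mono_onI rate_mono) auto
  qed (fact ln_e_convex rate_convergent)+
qed

end
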